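(* For all $r\ge0$ we have $\mathcal S_r\subset\mathcal E_r$: every $r$-homotopy equivalence of twisted complexes is an $E_r$-quasi-isomorphism.
   Context: $R$ is a commutative ring with unit. A bigraded module $A=\{A_i^j\}$ is a $(\mathbb Z,\mathbb Z)$-bigraded $R$-module; a map of bidegree $(p,q)$ sends $A_i^j$ to $A_{i+p}^{j+q}$. A twisted complex $(A,d_m)$ is a bigraded module $A$ with maps $d_m:A\to A$, $m\ge 0$, of bidegree $(-m,-m+1)$ such that $\sum_{i+j=m}(-1)^i d_id_j=0$ for all $m\ge0$. A morphism $f:(A,d^A_m)\to(B,d^B_m)$ is a family $f_m:A\to B$, $m\ge0$, of bidegree $(-m,-m)$ with $\sum_{i+j=m}d_i^Bf_j=\sum_{i+j=m}(-1)^if_id_j^A$ for all $m\geq0$. Composition is $(g\circ f)_m=\sum_{i+j=m}g_if_j$; a morphism is strict if $f_m=0$ for $m>0$. The $r$-path of $(A,d_m)$ is the twisted complex $P_r(A)_i^j:=A_i^j\oplus A_{i+r}^{j+r-1}\oplus A_i^j$ with $D_r(x,y,z)=(d_rx,-x-d_ry+z,d_rz)$ and $D_m(x,y,z)=(d_mx,(-1)^{m+r+1}d_my,d_mz)$ for $m\ne r$; $\partial_A^-(x,y,z)=x$ and $\partial_A^+(x,y,z)=z$ are strict morphisms $P_r(A)\to A$. An $r$-homotopy from $f$ to $g$, where $f,g:A\to B$, is a morphism of twisted complexes $h:A\to P_r(B)$ with $\partial_B^-h=f$, $\partial_B^+h=g$; one writes $f\simeq_rg$. A morphism $f:A\to B$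 is an $r$-homotopy equivalence if there is a morphism $g:B\to A$ with $fg\simeq_r1_B$ and $gf\simeq_r1_A$; $\mathcal S_r$ is the class of these. Total complex: $\mathrm{Tot}(A)^n=\prod_{i\le0}A_i^{n+i}\oplus\bigoplus_{i>0}A_i^{n+i}$ with increasing column filtration $F_p\mathrm{Tot}(A)^n=\prod_{i\le p}A_i^{n+i}$ and differential $d(a)_j=\sum_{m\ge0}(-1)^{mn}d_m(a_{j+m})$ for $a\in\mathrm{Tot}(A)^n$; a morphism $f$ induces the filtered chain map $(\mathrm{Tot}(f)(a))_j=\sum_{m\ge0}(-1)^{mn}f_m(a_{j+m})$. The spectral sequence $E_r^{*,*}(A)$ of $A$ is that of the filtered complex $\mathrm{Tot}(A)$, bigraded so that $E_0^{p,q}(A)=A_p^q$ and the differential $\delta_r$ of $E_r$ has bidegree $(-r,-r+1)$. A morphism $f$ is an $E_r$-quasi-isomorphism if $E_r(f)$ is a quasi-isomorphism with respect to $\delta_r$, i.e. $E_{r+1}^{*,*}(f)$ is an isomorphism; $\mathcal E_r$ is the class of these. *)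

theory Defs
  imports "HOL-Algebra.Module" "HOL-Algebra.AbelCoset"
begin

text \<open>
  Maps between modules are only meaningful on carriers, so a map of bigraded modules is a family
  \<open>f i j\<close> indexed by the bidegree of its source (the components of a bigraded module may share
  elements as HOL values), and equality of maps is equality on carriers.
\<close>


section \<open>Modules\<close>

definition module_hom ::
  "'a ring \<Rightarrow> ('a, 'b) module \<Rightarrow> ('a, 'c) module \<Rightarrow> ('b \<Rightarrow> 'c) set" where
  "module_hom R M N = {f. f \<in> carrier M \<rightarrow> carrier N \<and>
     (\<forall>x\<in>carrier M. \<forall>y\<in>carrier M. f (x \<oplus>\<^bsub>M\<^esub> y) = f x \<oplus>\<^bsub>N\<^esub> f y) \<and>
     (\<forall>c\<in>carrier R. \<forall>x\<in>carrier M. f (c \<odot>\<^bsub>M\<^esub> x) = c \<odot>\<^bsub>N\<^esub> f x)}"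

definition module_iso ::
  "'a ring \<Rightarrow> ('a, 'b) module \<Rightarrow> ('a, 'c) module \<Rightarrow> ('b \<Rightarrow> 'c) set" where
  "module_iso R M N = {f \<in> module_hom R M N. bij_betw f (carrier M) (carrier N)}"

text \<open>A module record extends a ring record; the inherited multiplicative fields play no role
  for modules and are left undefined in the constructions below.\<close>

definition direct_sum3 ::
  "('a, 'b) module \<Rightarrow> ('a, 'c) module \<Rightarrow> ('a, 'd) module \<Rightarrow> ('a, 'b \<times> 'c \<times> 'd) module" where
  "direct_sum3 L M N =
    \<lparr>carrier = carrier L \<times> carrier M \<times> carrier N,
     mult = undefined,
     one = undefined,
     zero = (\<zero>\<^bsub>L\<^esub>, \<zero>\<^bsub>M\<^esub>, \<zero>\<^bsub>N\<^esub>),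
     add = (\<lambda>(x, y, z) (x', y', z'). (x \<oplus>\<^bsub>L\<^esub> x', y \<oplus>\<^bsub>M\<^esub> y', z \<oplus>\<^bsub>N\<^esub> z')),
     smult = (\<lambda>c (x, y, z). (c \<odot>\<^bsub>L\<^esub> x, c \<odot>\<^bsub>M\<^esub> y, c \<odot>\<^bsub>N\<^esub> z))\<rparr>"

text \<open>The subquotient \<open>Z/B\<close> for submodules \<open>B \<subseteq> Z\<close> of \<open>M\<close>; its elements are the cosets of \<open>B\<close>.\<close>

definition subquotient ::
  "('a, 'b) module \<Rightarrow> 'b set \<Rightarrow> 'b set \<Rightarrow> ('a, 'b set) module" where
  "subquotient M Z B =
    \<lparr>carrier = {B +>\<^bsub>M\<^esub> z |z. z \<in> Z},
     mult = undefined,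
     one = undefined,
     zero = B,
     add = (\<lambda>X Y. X <+>\<^bsub>M\<^esub> Y),
     smult = (\<lambda>c X. \<Union>x\<in>X. B +>\<^bsub>M\<^esub> (c \<odot>\<^bsub>M\<^esub> x))\<rparr>"

text \<open>The map into a quotient by \<open>B\<close> induced on cosets by \<open>f\<close>: when \<open>f\<close> respects the cosets,
  all members of the union coincide.\<close>

definition coset_map :: "('a, 'c) module \<Rightarrow> 'c set \<Rightarrow> ('b \<Rightarrow> 'c) \<Rightarrow> 'b set \<Rightarrow> 'c set" where
  "coset_map N B f X = (\<Union>x\<in>X. B +>\<^bsub>N\<^esub> f x)"

text \<open>\<open>(-1)\<^sup>k x\<close>\<close>

definition msign :: "('a, 'b) module \<Rightarrow> int \<Rightarrow> 'b \<Rightarrow> 'b" where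
  "msign M k x = (if even k then x else \<ominus>\<^bsub>M\<^esub> x)"


section \<open>Twisted complexes\<close>

text \<open>\<open>cmp A i j\<close> is \<open>A\<^sub>i\<^sup>j\<close>, and \<open>tdiff A m i j\<close> is the restriction
  of \<open>d\<^sub>m\<close> to \<open>A\<^sub>i\<^sup>j\<close>.\<close>

record ('a, 'b) twisted =
  cmp :: "int \<Rightarrow> int \<Rightarrow> ('a, 'b) module"
  tdiff :: "nat \<Rightarrow> int \<Rightarrow> int \<Rightarrow> 'b \<Rightarrow> 'b"

definition twisted_complex :: "'a ring \<Rightarrow> ('a, 'b) twisted \<Rightarrow> bool" where
  "twisted_complex R A \<longleftrightarrow>
     (\<forall>i j. module R (cmp A i j)) \<and>
     (\<forall>m i j. tdiff A m i j \<in> module_hom R (cmp A i j) (cmp A (i - int m) (j - int m + 1))) \<and>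
     (\<forall>m i j. \<forall>x\<in>carrier (cmp A i j).
        (let T = cmp A (i - int m) (j - int m + 2) in
         (\<Oplus>\<^bsub>T\<^esub> k\<in>{..m}. msign T (int k)
            (tdiff A k (i - int (m - k)) (j - int (m - k) + 1) (tdiff A (m - k) i j x))) = \<zero>\<^bsub>T\<^esub>))"

type_synonym ('b, 'c) tmap = "nat \<Rightarrow> int \<Rightarrow> int \<Rightarrow> 'b \<Rightarrow> 'c"

definition tmorphism ::
  "'a ring \<Rightarrow> ('a, 'b) twisted \<Rightarrow> ('a, 'c) twisted \<Rightarrow> ('b, 'c) tmap \<Rightarrow> bool" where
  "tmorphism R A B f \<longleftrightarrow>
     (\<forall>m i j. f m i j \<in> module_hom R (cmp A i j) (cmp B (i - int m) (j - int m))) \<and>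
     (\<forall>m i j. \<forall>x\<in>carrier (cmp A i j).
        (let T = cmp B (i - int m) (j - int m + 1) in
         (\<Oplus>\<^bsub>T\<^esub> k\<in>{..m}. tdiff B k (i - int (m - k)) (j - int (m - k)) (f (m - k) i j x)) =
         (\<Oplus>\<^bsub>T\<^esub> k\<in>{..m}. msign T (int k)
            (f k (i - int (m - k)) (j - int (m - k) + 1) (tdiff A (m - k) i j x)))))"

definition tmap_eq :: "('a, 'b) twisted \<Rightarrow> ('b, 'c) tmap \<Rightarrow> ('b, 'c) tmap \<Rightarrow> bool" where
  "tmap_eq A f g \<longleftrightarrow> (\<forall>m i j. \<forall>x\<in>carrier (cmp A i j). f m i j x = g m i j x)"

text \<open>\<open>tcomp C g f\<close> is \<open>g \<circ> f\<close>, where \<open>C\<close> is the target of \<open>g\<close>.\<close>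

definition tcomp :: "('a, 'd) twisted \<Rightarrow> ('c, 'd) tmap \<Rightarrow> ('b, 'c) tmap \<Rightarrow> ('b, 'd) tmap" where
  "tcomp C g f m i j x =
     (\<Oplus>\<^bsub>cmp C (i - int m) (j - int m)\<^esub> k\<in>{..m}.
        g k (i - int (m - k)) (j - int (m - k)) (f (m - k) i j x))"

text \<open>\<open>strict_tmap B \<phi>\<close> is the strict map into \<open>B\<close> with \<open>\<phi>\<close> as its component of index \<open>0\<close>.\<close>

definition strict_tmap :: "('a, 'c) twisted \<Rightarrow> (int \<Rightarrow> int \<Rightarrow> 'b \<Rightarrow> 'c) \<Rightarrow> ('b, 'c) tmap" where
  "strict_tmap B \<phi> m i j x = (if m = 0 then \<phi> i j x else \<zero>\<^bsub>cmp B (i - int m) (j - int m)\<^esub>)"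

definition tident :: "('a, 'b) twisted \<Rightarrow> ('b, 'b) tmap" where
  "tident A = strict_tmap A (\<lambda>i j x. x)"


section \<open>Homotopies\<close>

definition path :: "nat \<Rightarrow> ('a, 'b) twisted \<Rightarrow> ('a, 'b \<times> 'b \<times> 'b) twisted" where
  "path r A =
    \<lparr>cmp = (\<lambda>i j. direct_sum3 (cmp A i j) (cmp A (i + int r) (j + int r - 1)) (cmp A i j)),
     tdiff = (\<lambda>m i j (x, y, z).
       (tdiff A m i j x,
        (if m = r
         then \<ominus>\<^bsub>cmp A i j\<^esub> x \<ominus>\<^bsub>cmp A i j\<^esub> tdiff A r (i + int r) (j + int r - 1) y \<oplus>\<^bsub>cmp A i j\<^esub> z
         else msign (cmp A (i - int m + int r) (j - int m + 1 + int r - 1)) (int m + int r + 1)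
                (tdiff A m (i + int r) (j + int r - 1) y)),
        tdiff A m i j z))\<rparr>"

definition path_src :: "('a, 'b) twisted \<Rightarrow> ('b \<times> 'b \<times> 'b, 'b) tmap" where
  "path_src A = strict_tmap A (\<lambda>i j (x, y, z). x)"

definition path_tgt :: "('a, 'b) twisted \<Rightarrow> ('b \<times> 'b \<times> 'b, 'b) tmap" where
  "path_tgt A = strict_tmap A (\<lambda>i j (x, y, z). z)"

definition homotopy ::
  "'a ring \<Rightarrow> nat \<Rightarrow> ('a, 'b) twisted \<Rightarrow> ('a, 'c) twisted \<Rightarrow>
    ('b, 'c \<times> 'c \<times> 'c) tmap \<Rightarrow> ('b, 'c) tmap \<Rightarrow> ('b, 'c) tmap \<Rightarrow> bool" where
  "homotopy R r A B h f g \<longleftrightarrow>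
     tmorphism R A (path r B) h \<and>
     tmap_eq A (tcomp B (path_src B) h) f \<and>
     tmap_eq A (tcomp B (path_tgt B) h) g"

definition homotopic ::
  "'a ring \<Rightarrow> nat \<Rightarrow> ('a, 'b) twisted \<Rightarrow> ('a, 'c) twisted \<Rightarrow>
    ('b, 'c) tmap \<Rightarrow> ('b, 'c) tmap \<Rightarrow> bool" where
  "homotopic R r A B f g \<longleftrightarrow> (\<exists>h. homotopy R r A B h f g)"

definition homotopy_equivalence ::
  "'a ring \<Rightarrow> nat \<Rightarrow> ('a, 'b) twisted \<Rightarrow> ('a, 'c) twisted \<Rightarrow> ('b, 'c) tmap \<Rightarrow> bool" where
  "homotopy_equivalence R r A B f \<longleftrightarrow>
     (\<exists>g. tmorphism R B A g \<and>
       homotopic R r B B (tcomp B f g) (tident B) \<and>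
       homotopic R r A A (tcomp A g f) (tident A))"

text \<open>The class \<open>S\<^sub>r\<close>; a morphism carries its source and target.\<close>

definition homotopy_equivalences ::
  "'a ring \<Rightarrow> nat \<Rightarrow> (('a, 'b) twisted \<times> ('a, 'c) twisted \<times> ('b, 'c) tmap) set" where
  "homotopy_equivalences R r = {(A, B, f). twisted_complex R A \<and> twisted_complex R B \<and>
     tmorphism R A B f \<and> homotopy_equivalence R r A B f}"


section \<open>The spectral sequence of a filtered complex\<close>

text \<open>Cochain complexes with an increasing filtration: \<open>fc_filt K p n\<close> is \<open>F\<^sub>p K\<^sup>n\<close>.\<close>

record ('a, 'b) filtered_complex =
  fc_mod :: "int \<Rightarrow> ('a, 'b) module"
  fc_diff :: "int \<Rightarrow> 'b \<Rightarrow> 'b"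
  fc_filt :: "int \<Rightarrow> int \<Rightarrow> 'b set"

definition ss_cycles :: "('a, 'b) filtered_complex \<Rightarrow> int \<Rightarrow> int \<Rightarrow> int \<Rightarrow> 'b set" where
  "ss_cycles K r p n = {x \<in> fc_filt K p n. fc_diff K n x \<in> fc_filt K (p - r) (n + 1)}"

text \<open>Here \<open>r = 0\<close> gives \<open>F\<^sub>p\<^sub>-\<^sub>1 K\<^sup>n\<close>, since then both summands involve \<open>ss_cycles K (-1) (p - 1)\<close>,
  which is all of \<open>F\<^sub>p\<^sub>-\<^sub>1\<close>.\<close>

definition ss_boundaries :: "('a, 'b) filtered_complex \<Rightarrow> int \<Rightarrow> int \<Rightarrow> int \<Rightarrow> 'b set" where
  "ss_boundaries K r p n =
     fc_diff K (n - 1) ` ss_cycles K (r - 1) (p + r - 1) (n - 1)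
       <+>\<^bsub>fc_mod K n\<^esub> ss_cycles K (r - 1) (p - 1) n"

text \<open>The bidegree \<open>(p, q)\<close> corresponds to filtration degree \<open>p\<close> and total degree \<open>q - p\<close>; thus
  for the filtered complex \<open>Tot(A)\<close> below \<open>E\<^sub>0\<^sup>p\<^sup>,\<^sup>q\<close> is \<open>A\<^sub>p\<^sup>q\<close>.\<close>

definition ss_page :: "('a, 'b) filtered_complex \<Rightarrow> nat \<Rightarrow> int \<Rightarrow> int \<Rightarrow> ('a, 'b set) module" where
  "ss_page K r p q = subquotient (fc_mod K (q - p))
     (ss_cycles K (int r) p (q - p)) (ss_boundaries K (int r) p (q - p))"

definition ss_page_map ::
  "('a, 'c) filtered_complex \<Rightarrow> (int \<Rightarrow> 'b \<Rightarrow> 'c) \<Rightarrow> nat \<Rightarrow> int \<Rightarrow> int \<Rightarrow> 'b set \<Rightarrow> 'c set" where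
  "ss_page_map L \<phi> r p q =
     coset_map (fc_mod L (q - p)) (ss_boundaries L (int r) p (q - p)) (\<phi> (q - p))"

text \<open>The differential \<open>\<delta>\<^sub>r\<close> from bidegree \<open>(p, q)\<close> to bidegree \<open>(p - r, q - r + 1)\<close>.\<close>

definition ss_diff ::
  "('a, 'b) filtered_complex \<Rightarrow> nat \<Rightarrow> int \<Rightarrow> int \<Rightarrow> 'b set \<Rightarrow> 'b set" where
  "ss_diff K r p q =
     coset_map (fc_mod K (q - p + 1)) (ss_boundaries K (int r) (p - int r) (q - p + 1))
       (fc_diff K (q - p))"

definition ss_diff_kernel ::
  "('a, 'b) filtered_complex \<Rightarrow> nat \<Rightarrow> int \<Rightarrow> int \<Rightarrow> 'b set set" where
  "ss_diff_kernel K r p q =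
     a_kernel (ss_page K r p q) (ss_page K r (p - int r) (q - int r + 1)) (ss_diff K r p q)"

definition ss_diff_image ::
  "('a, 'b) filtered_complex \<Rightarrow> nat \<Rightarrow> int \<Rightarrow> int \<Rightarrow> 'b set set" where
  "ss_diff_image K r p q =
     ss_diff K r (p + int r) (q + int r - 1) ` carrier (ss_page K r (p + int r) (q + int r - 1))"

text \<open>The homology \<open>H(E\<^sub>r, \<delta>\<^sub>r)\<close> in bidegree \<open>(p, q)\<close>.\<close>

definition ss_homology ::
  "('a, 'b) filtered_complex \<Rightarrow> nat \<Rightarrow> int \<Rightarrow> int \<Rightarrow> ('a, 'b set set) module" where
  "ss_homology K r p q =
     subquotient (ss_page K r p q) (ss_diff_kernel K r p q) (ss_diff_image K r p q)"

definition ss_homology_map ::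
  "('a, 'c) filtered_complex \<Rightarrow> (int \<Rightarrow> 'b \<Rightarrow> 'c) \<Rightarrow> nat \<Rightarrow> int \<Rightarrow> int \<Rightarrow>
    'b set set \<Rightarrow> 'c set set" where
  "ss_homology_map L \<phi> r p q =
     coset_map (ss_page L r p q) (ss_diff_image L r p q) (ss_page_map L \<phi> r p q)"


section \<open>Total complex\<close>

definition tot_mod :: "('a, 'b) twisted \<Rightarrow> int \<Rightarrow> ('a, int \<Rightarrow> 'b) module" where
  "tot_mod A n =
    \<lparr>carrier = {a. (\<forall>i. a i \<in> carrier (cmp A i (n + i))) \<and>
                   finite {i. i > 0 \<and> a i \<noteq> \<zero>\<^bsub>cmp A i (n + i)\<^esub>}},
     mult = undefined,
     one = undefined,
     zero = (\<lambda>i. \<zero>\<^bsub>cmp A i (n + i)\<^esub>),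
     add = (\<lambda>a b i. a i \<oplus>\<^bsub>cmp A i (n + i)\<^esub> b i),
     smult = (\<lambda>c a i. c \<odot>\<^bsub>cmp A i (n + i)\<^esub> a i)\<rparr>"

definition tot_filt :: "('a, 'b) twisted \<Rightarrow> int \<Rightarrow> int \<Rightarrow> (int \<Rightarrow> 'b) set" where
  "tot_filt A p n = {a \<in> carrier (tot_mod A n). \<forall>i>p. a i = \<zero>\<^bsub>cmp A i (n + i)\<^esub>}"

text \<open>\<open>finsum\<close> is zero on infinite index sets, so the sums over all \<open>m \<ge> 0\<close> are taken over the
  \<open>m\<close> with \<open>a (j + m) \<noteq> 0\<close>; these are finitely many for \<open>a\<close> in \<open>Tot(A)\<^sup>n\<close>, and the omitted
  summands vanish.\<close>

definition tot_diff :: "('a, 'b) twisted \<Rightarrow> int \<Rightarrow> (int \<Rightarrow> 'b) \<Rightarrow> int \<Rightarrow> 'b" where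
  "tot_diff A n a j =
     (\<Oplus>\<^bsub>cmp A j (n + 1 + j)\<^esub>
        m\<in>{m. a (j + int m) \<noteq> \<zero>\<^bsub>cmp A (j + int m) (n + (j + int m))\<^esub>}.
        msign (cmp A j (n + 1 + j)) (int m * n)
          (tdiff A m (j + int m) (n + (j + int m)) (a (j + int m))))"

definition tot_map ::
  "('a, 'b) twisted \<Rightarrow> ('a, 'c) twisted \<Rightarrow> ('b, 'c) tmap \<Rightarrow> int \<Rightarrow> (int \<Rightarrow> 'b) \<Rightarrow> int \<Rightarrow> 'c" where
  "tot_map A B f n a j =
     (\<Oplus>\<^bsub>cmp B j (n + j)\<^esub>
        m\<in>{m. a (j + int m) \<noteq> \<zero>\<^bsub>cmp A (j + int m) (n + (j + int m))\<^esub>}.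
        msign (cmp B j (n + j)) (int m * n)
          (f m (j + int m) (n + (j + int m)) (a (j + int m))))"

definition Tot :: "('a, 'b) twisted \<Rightarrow> ('a, int \<Rightarrow> 'b) filtered_complex" where
  "Tot A = \<lparr>fc_mod = tot_mod A, fc_diff = tot_diff A, fc_filt = tot_filt A\<rparr>"

text \<open>\<open>E\<^sub>r(f)\<close> is a quasi-isomorphism with respect to \<open>\<delta>\<^sub>r\<close>.\<close>

definition E_quasi_iso ::
  "'a ring \<Rightarrow> nat \<Rightarrow> ('a, 'b) twisted \<Rightarrow> ('a, 'c) twisted \<Rightarrow> ('b, 'c) tmap \<Rightarrow> bool" where
  "E_quasi_iso R r A B f \<longleftrightarrow>
     (\<forall>p q. ss_homology_map (Tot B) (tot_map A B f) r p q
        \<in> module_iso R (ss_homology (Tot A) r p q) (ss_homology (Tot B) r p q))"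

definition E_quasi_isos ::
  "'a ring \<Rightarrow> nat \<Rightarrow> (('a, 'b) twisted \<times> ('a, 'c) twisted \<times> ('b, 'c) tmap) set" where
  "E_quasi_isos R r = {(A, B, f). twisted_complex R A \<and> twisted_complex R B \<and>
     tmorphism R A B f \<and> E_quasi_iso R r A B f}"

end

(* The total complex turns a morphism of twisted complexes into a filtered chain map, and the middle
   component of an r-homotopy from f to g into a map h with Tot(g) - Tot(f) = d h + h d that raises
   the filtration by r.  All identities between total maps reduce to identities between lower
   triangular matrices of module homomorphisms, whose composition is the convolution occurring in
   the axioms for twisted complexes and their morphisms.
   A class in the kernel of delta_r has a representative x with d x in F_(p-r-1); then h d x lies in
   F_(p-1) and vanishes on the page E_r, while d h x represents delta_r [h x].  Hence Tot(g) and
   Tot(f) agree on H(E_r, delta_r), and a homotopy inverse induces an inverse there. *)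

theory Submission
  imports Defs
begin

section \<open>Modules and subquotients\<close>

text \<open>The sign (-1)^(m*n) of the total complex is what makes composition match the axioms:
  when a map of total degree 0 is applied first, the products carry no inner sign, and after a map
  of degree 1 or -1 they alternate with the index of the second factor. These are the two sign
  patterns in the definitions of twisted complexes and morphisms, and everything else is one common
  sign per matrix entry. Elements of the total complex may have infinitely many nonzero components
  in negative columns. They vanish above some column, however, and a matrix raises columns by at
  most a fixed amount, so each component of a composite is a finite sum and sums can be interchanged
  without any limit. Only homotopies from a composite to the identity are converted. The composite
  enters through its entries, which are compared with a product of matrices. On a page, the argument
  treats one kernel class at a time. The homotopy enters only through its filtration bound and its
  identity, and no chain homotopy on E_r is built. The bound by r is exactly what lets h of a
  suitable r-cycle be an r-cycle, r columns higher.\<close>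

lemma module_homD:
  assumes "f \<in> module_hom R M N"
  shows "\<And>x. x \<in> carrier M \<Longrightarrow> f x \<in> carrier N"
    and "\<And>x y. x \<in> carrier M \<Longrightarrow> y \<in> carrier M \<Longrightarrow> f (x \<oplus>\<^bsub>M\<^esub> y) = f x \<oplus>\<^bsub>N\<^esub> f y"
    and "\<And>c x. c \<in> carrier R \<Longrightarrow> x \<in> carrier M \<Longrightarrow> f (c \<odot>\<^bsub>M\<^esub> x) = c \<odot>\<^bsub>N\<^esub> f x"
  using assms by (auto simp: module_hom_def)

lemma module_homI:
  assumes "\<And>x. x \<in> carrier M \<Longrightarrow> f x \<in> carrier N"
    and "\<And>x y. x \<in> carrier M \<Longrightarrow> y \<in> carrier M \<Longrightarrow> f (x \<oplus>\<^bsub>M\<^esub> y) = f x \<oplus>\<^bsub>N\<^esub> f y"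
    and "\<And>c x. c \<in> carrier R \<Longrightarrow> x \<in> carrier M \<Longrightarrow> f (c \<odot>\<^bsub>M\<^esub> x) = c \<odot>\<^bsub>N\<^esub> f x"
  shows "f \<in> module_hom R M N"
  using assms by (auto simp: module_hom_def)

lemma module_abelian_group: "module R M \<Longrightarrow> abelian_group M"
  by (rule module.axioms(2))

lemma module_hom_abelian_group_hom:
  assumes "module R M" "module R N" "f \<in> module_hom R M N"
  shows "abelian_group_hom M N f"
proof -
  interpret M: module R M by fact
  interpret N: module R N by fact
  have "f \<in> hom (add_monoid M) (add_monoid N)"
    using module_homD(1,2)[OF assms(3)] by (simp add: hom_def)
  then show ?thesis
    by (intro abelian_group_homI M.abelian_group_axioms N.abelian_group_axioms
        group_hom.intro group_hom_axioms.intro M.add.group_axioms N.add.group_axioms)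
qed

lemma module_hom_zero:
  assumes "module R M" "module R N" "f \<in> module_hom R M N"
  shows "f \<zero>\<^bsub>M\<^esub> = \<zero>\<^bsub>N\<^esub>"
  by (rule abelian_group_hom.hom_zero[OF module_hom_abelian_group_hom[OF assms]])

lemma module_hom_uminus:
  assumes "module R M" "module R N" "f \<in> module_hom R M N" "x \<in> carrier M"
  shows "f (\<ominus>\<^bsub>M\<^esub> x) = \<ominus>\<^bsub>N\<^esub> f x"
  by (rule abelian_group_hom.hom_a_inv[OF module_hom_abelian_group_hom[OF assms(1-3)] assms(4)])

lemma module_hom_minus:
  assumes "module R M" "module R N" "f \<in> module_hom R M N" "x \<in> carrier M" "y \<in> carrier M"
  shows "f (x \<ominus>\<^bsub>M\<^esub> y) = f x \<ominus>\<^bsub>N\<^esub> f y"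
proof -
  interpret M: module R M by fact
  show ?thesis
    using assms by (simp add: a_minus_def module_homD[OF assms(3)] module_hom_uminus)
qed

lemma (in abelian_group) minus_eqI:
  assumes "x = y \<oplus> z" "y \<in> carrier G" "z \<in> carrier G"
  shows "x \<ominus> y = z"
  using assms by (simp add: a_minus_def a_comm r_neg1)

text \<open>Serves to solve a homotopy identity x = \<theta> x + (d h x + h d x) for its middle term
  d h x.\<close>

lemma (in abelian_group) minus_minus_eqI:
  assumes "x = a \<oplus> (b \<oplus> c)" "a \<in> carrier G" "b \<in> carrier G" "c \<in> carrier G"
  shows "x \<ominus> a \<ominus> c = b"
proof -
  have "x \<ominus> a = b \<oplus> c" using assms by (intro minus_eqI) simp_all
  then show ?thesis using assms by (intro minus_eqI) (simp_all add: a_comm)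
qed

section \<open>Cosets, subquotient modules and induced maps\<close>

lemma submodule_abelian_subgroup:
  assumes "module R M" "submodule B R M"
  shows "abelian_subgroup B M"
  by (intro abelian_subgroupI3 additive_subgroup.intro submodule.axioms(1)[OF assms(2)]
      module_abelian_group[OF assms(1)])

lemma submodule_minus:
  assumes "module R M" "submodule B R M" "x \<in> B" "y \<in> B"
  shows "x \<ominus>\<^bsub>M\<^esub> y \<in> B"
  using module.submoduleE(3,5)[OF assms(1,2)] assms(3,4) by (auto simp: a_minus_def)

lemma submodule_zero:
  assumes "module R M" "submodule B R M"
  shows "\<zero>\<^bsub>M\<^esub> \<in> B"
  by (rule additive_subgroup.zero_closed
      [OF abelian_subgroup.axioms(1)[OF submodule_abelian_subgroup[OF assms]]])

lemma coset_eq_iff: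
  assumes "module R M" "submodule B R M" "x \<in> carrier M" "y \<in> carrier M"
  shows "B +>\<^bsub>M\<^esub> x = B +>\<^bsub>M\<^esub> y \<longleftrightarrow> x \<ominus>\<^bsub>M\<^esub> y \<in> B"
proof -
  interpret M: module R M by fact
  interpret abelian_subgroup B M by (rule submodule_abelian_subgroup) fact+
  show ?thesis
    unfolding a_minus_def
    using a_rcos_module[OF assms(4,3)] a_repr_independence'[of x y]
      a_repr_independenceD[OF assms(3), of y] assms(4) by metis
qed

lemma subquotient_carrier_iff:
  "X \<in> carrier (subquotient M Z B) \<longleftrightarrow> (\<exists>z\<in>Z. X = B +>\<^bsub>M\<^esub> z)"
  by (auto simp: subquotient_def)

lemma coset_self:
  assumes "module R M" "submodule B R M" "x \<in> carrier M"
  shows "x \<in> B +>\<^bsub>M\<^esub> x"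
proof -
  interpret abelian_subgroup B M by (rule submodule_abelian_subgroup) fact+
  show ?thesis using assms(3) by (rule a_rcos_self)
qed

lemma coset_mem_eq:
  assumes "module R M" "submodule B R M" "x \<in> carrier M" "y \<in> B +>\<^bsub>M\<^esub> x"
  shows "y \<in> carrier M" "B +>\<^bsub>M\<^esub> y = B +>\<^bsub>M\<^esub> x"
proof -
  interpret abelian_subgroup B M by (rule submodule_abelian_subgroup) fact+
  show "y \<in> carrier M" using assms(4,3) a_elemrcos_carrier by blast
  show "B +>\<^bsub>M\<^esub> y = B +>\<^bsub>M\<^esub> x" using a_repr_independence'[OF assms(4,3)] by simp
qed

text \<open>Two representatives of a coset differ by an element of \<open>B\<close>, which
  \<open>f\<close> sends into \<open>C\<close>. So all members of the union in
  \<open>coset_map\<close> are the same coset.\<close>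

lemma coset_map_coset:
  assumes "module R M" "module R N" "submodule B R M" "submodule C R N"
    and f: "f \<in> module_hom R M N" and fB: "f ` B \<subseteq> C" and x: "x \<in> carrier M"
  shows "coset_map N C f (B +>\<^bsub>M\<^esub> x) = C +>\<^bsub>N\<^esub> f x"
proof -
  have "C +>\<^bsub>N\<^esub> f y = C +>\<^bsub>N\<^esub> f x" if "y \<in> B +>\<^bsub>M\<^esub> x" for y
  proof -
    have y: "y \<in> carrier M" and "B +>\<^bsub>M\<^esub> y = B +>\<^bsub>M\<^esub> x"
      using coset_mem_eq[OF assms(1,3) x that] by auto
    then have "y \<ominus>\<^bsub>M\<^esub> x \<in> B" using coset_eq_iff[OF assms(1,3) _ x] by blast
    then have "f y \<ominus>\<^bsub>N\<^esub> f x \<in> C" using fB module_hom_minus[OF assms(1,2) f y x] by fastforce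
    then show ?thesis
      using coset_eq_iff[OF assms(2,4)] module_homD(1)[OF f] x y by blast
  qed
  then show ?thesis
    using coset_self[OF assms(1,3) x] unfolding coset_map_def by blast
qed

lemma subquotient_add:
  assumes "module R M" "submodule B R M" "x \<in> carrier M" "y \<in> carrier M"
  shows "(B +>\<^bsub>M\<^esub> x) \<oplus>\<^bsub>subquotient M Z B\<^esub> (B +>\<^bsub>M\<^esub> y) = B +>\<^bsub>M\<^esub> (x \<oplus>\<^bsub>M\<^esub> y)"
proof -
  interpret abelian_subgroup B M by (rule submodule_abelian_subgroup) fact+
  show ?thesis using assms(3,4) by (simp add: subquotient_def a_rcos_sum)
qed

lemma smult_module_hom:
  assumes "module R M" and "c \<in> carrier R"
  shows "(\<lambda>x. c \<odot>\<^bsub>M\<^esub> x) \<in> module_hom R M M"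
proof -
  interpret module R M by fact
  show ?thesis
  proof (intro module_homI)
    fix d x assume "d \<in> carrier R" "x \<in> carrier M"
    then show "c \<odot>\<^bsub>M\<^esub> (d \<odot>\<^bsub>M\<^esub> x) = d \<odot>\<^bsub>M\<^esub> (c \<odot>\<^bsub>M\<^esub> x)"
      using assms(2) by (metis R.m_comm smult_assoc1)
  qed (use assms(2) in \<open>simp_all add: smult_r_distr\<close>)
qed

text \<open>The union defining scalar multiplication on a subquotient is \<open>coset_map\<close>
  for multiplication by \<open>c\<close>, so it collapses for the same reason.\<close>

lemma subquotient_smult:
  fixes R :: "'a ring" and M :: "('a, 'b) module"
  assumes "module R M" "submodule B R M" "c \<in> carrier R" "x \<in> carrier M"
  shows "c \<odot>\<^bsub>subquotient M Z B\<^esub> (B +>\<^bsub>M\<^esub> x) = B +>\<^bsub>M\<^esub> (c \<odot>\<^bsub>M\<^esub> x)"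
proof -
  have "c \<odot>\<^bsub>subquotient M Z B\<^esub> (B +>\<^bsub>M\<^esub> x) = coset_map M B (\<lambda>x. c \<odot>\<^bsub>M\<^esub> x) (B +>\<^bsub>M\<^esub> x)"
    by (simp add: subquotient_def coset_map_def)
  also have "\<dots> = B +>\<^bsub>M\<^esub> (c \<odot>\<^bsub>M\<^esub> x)"
    using module.submoduleE(4)[OF assms(1,2,3)]
    by (intro coset_map_coset[OF assms(1,1,2,2) smult_module_hom[OF assms(1,3)] _ assms(4)]) auto
  finally show ?thesis .
qed

lemma subquotient_zero:
  assumes "module R M" "submodule B R M"
  shows "\<zero>\<^bsub>subquotient M Z B\<^esub> = B +>\<^bsub>M\<^esub> \<zero>\<^bsub>M\<^esub>"
proof -
  interpret abelian_subgroup B M by (rule submodule_abelian_subgroup) fact+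
  show ?thesis by (simp add: subquotient_def a_subset)
qed

lemma coset_eq_zero_iff:
  assumes "module R M" "submodule B R M" "x \<in> carrier M"
  shows "B +>\<^bsub>M\<^esub> x = \<zero>\<^bsub>subquotient M Z B\<^esub> \<longleftrightarrow> x \<in> B"
proof -
  interpret module R M by fact
  have "x \<ominus>\<^bsub>M\<^esub> \<zero>\<^bsub>M\<^esub> = x" using assms(3) by (simp add: a_minus_def)
  then show ?thesis
    using coset_eq_iff[OF assms, of "\<zero>\<^bsub>M\<^esub>"] subquotient_zero[OF assms(1,2)] by simp
qed

lemma module_subquotient:
  fixes R :: "'a ring" and M :: "('a, 'b) module"
  assumes "module R M" "submodule Z R M" "submodule B R M"
  shows "module R (subquotient M Z B)"
proof -
  interpret M: module R M by fact
  note Z = M.submoduleE[OF assms(2)]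
  note ZM = subsetD[OF Z(1)]
  note add = subquotient_add[OF assms(1,3)]
  note smult = subquotient_smult[OF assms(1,3)]
  note zero = subquotient_zero[OF assms(1,3)]
  have [simp]: "\<zero>\<^bsub>M\<^esub> \<in> Z" by (rule submodule_zero[OF assms(1,2)])
  have mem: "X \<in> carrier (subquotient M Z B) \<Longrightarrow> \<exists>z. z \<in> Z \<and> z \<in> carrier M \<and> X = B +>\<^bsub>M\<^esub> z" for X
    using subquotient_carrier_iff[of X M Z B] ZM by blast
  have memI: "z \<in> Z \<Longrightarrow> B +>\<^bsub>M\<^esub> z \<in> carrier (subquotient M Z B)" for z
    by (auto simp: subquotient_carrier_iff)
  have "abelian_group (subquotient M Z B)"
  proof (rule abelian_groupI, goal_cases)
    case (6 X)
    then obtain x where x: "x \<in> Z" "x \<in> carrier M" "X = B +>\<^bsub>M\<^esub> x" using mem by blast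
    have "(B +>\<^bsub>M\<^esub> (\<ominus>\<^bsub>M\<^esub> x)) \<oplus>\<^bsub>subquotient M Z B\<^esub> X = \<zero>\<^bsub>subquotient M Z B\<^esub>"
      using x by (simp add: add zero M.l_neg)
    then show ?case using memI[OF Z(3)[OF x(1)]] by blast
  next
    case (3 X Y V)
    then obtain x y v where "x \<in> carrier M" "X = B +>\<^bsub>M\<^esub> x" "y \<in> carrier M" "Y = B +>\<^bsub>M\<^esub> y"
      "v \<in> carrier M" "V = B +>\<^bsub>M\<^esub> v" using mem by meson
    then show ?case by (simp add: add M.a_assoc)
  next
    case (4 X Y)
    then obtain x y where "x \<in> carrier M" "X = B +>\<^bsub>M\<^esub> x" "y \<in> carrier M" "Y = B +>\<^bsub>M\<^esub> y"
      using mem by meson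
    then show ?case by (simp add: add M.a_comm)
  next
    case (5 X)
    then obtain x where "x \<in> carrier M" "X = B +>\<^bsub>M\<^esub> x" using mem by meson
    then show ?case by (simp add: add zero del: M.a_coset_add_zero)
  next
    case (1 X Y)
    then obtain x y where "x \<in> Z" "x \<in> carrier M" "X = B +>\<^bsub>M\<^esub> x"
      "y \<in> Z" "y \<in> carrier M" "Y = B +>\<^bsub>M\<^esub> y" using mem by meson
    then show ?case using memI[OF Z(5)] by (simp add: add)
  qed (auto simp: zero memI simp del: M.a_coset_add_zero)
  then show ?thesis
  proof (intro moduleI, goal_cases)
    case (3 c X)
    then obtain x where "x \<in> Z" "x \<in> carrier M" "X = B +>\<^bsub>M\<^esub> x" using mem by meson
    then show ?case using memI[OF Z(4)] 3 by (simp add: smult)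
  next
    case (4 a b X)
    then obtain x where "x \<in> carrier M" "X = B +>\<^bsub>M\<^esub> x" using mem by meson
    then show ?case using 4 by (simp add: add smult M.smult_l_distr)
  next
    case (5 c X Y)
    then obtain x y where "x \<in> carrier M" "X = B +>\<^bsub>M\<^esub> x" "y \<in> carrier M" "Y = B +>\<^bsub>M\<^esub> y"
      using mem by meson
    then show ?case using 5 by (simp add: add smult M.smult_r_distr)
  next
    case (6 a b X)
    then obtain x where "x \<in> carrier M" "X = B +>\<^bsub>M\<^esub> x" using mem by meson
    then show ?case using 6 by (simp add: smult M.smult_assoc1)
  next
    case (7 X)
    then obtain x where "x \<in> carrier M" "X = B +>\<^bsub>M\<^esub> x" using mem by meson
    then show ?case by (simp add: smult)
  qed (rule M.R.cring_axioms, assumption)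
qed

lemma coset_map_module_hom:
  assumes "module R M" "module R N" "submodule B R M" "submodule C R N"
    and f: "f \<in> module_hom R M N" and "f ` B \<subseteq> C"
    and "Z \<subseteq> carrier M" "f ` Z \<subseteq> W"
  shows "coset_map N C f \<in> module_hom R (subquotient M Z B) (subquotient N W C)"
proof -
  interpret M: module R M by fact
  have eq: "coset_map N C f (B +>\<^bsub>M\<^esub> x) = C +>\<^bsub>N\<^esub> f x" if "x \<in> carrier M" for x
    using coset_map_coset[OF assms(1-6)] that .
  have ZM: "x \<in> carrier M" if "x \<in> Z" for x using that assms(7) by auto
  have W: "f x \<in> W" if "x \<in> Z" for x using that assms(8) by auto
  show ?thesis
    by (rule module_homI)
      (auto simp: subquotient_carrier_iff eq ZM subquotient_add[OF assms(1,3)]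
        subquotient_add[OF assms(2,4)] subquotient_smult[OF assms(1,3)]
        subquotient_smult[OF assms(2,4)] module_homD[OF f] intro: W)
qed

text \<open>The map induced by \<open>g\<close> is a two-sided inverse. The composites are compared
  with the identity only on \<open>Z\<close> and \<open>W\<close> and only modulo \<open>B\<close>
  and \<open>C\<close>, which is precisely what a homotopy provides on kernel classes.\<close>

lemma coset_map_module_iso:
  assumes M: "module R M" and N: "module R N" and B: "submodule B R M" and C: "submodule C R N"
    and f: "f \<in> module_hom R M N" "f ` B \<subseteq> C" "f ` Z \<subseteq> W"
    and g: "g \<in> module_hom R N M" "g ` C \<subseteq> B" "g ` W \<subseteq> Z"
    and Z: "Z \<subseteq> carrier M" and W: "W \<subseteq> carrier N"
    and gf: "\<And>x. x \<in> Z \<Longrightarrow> B +>\<^bsub>M\<^esub> g (f x) = B +>\<^bsub>M\<^esub> x"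
    and fg: "\<And>x. x \<in> W \<Longrightarrow> C +>\<^bsub>N\<^esub> f (g x) = C +>\<^bsub>N\<^esub> x"
  shows "coset_map N C f \<in> module_iso R (subquotient M Z B) (subquotient N W C)"
proof -
  have hom: "coset_map N C f \<in> module_hom R (subquotient M Z B) (subquotient N W C)"
    "coset_map M B g \<in> module_hom R (subquotient N W C) (subquotient M Z B)"
    by (rule coset_map_module_hom; fact)+
  have F: "coset_map N C f (B +>\<^bsub>M\<^esub> x) = C +>\<^bsub>N\<^esub> f x" if "x \<in> carrier M" for x
    using coset_map_coset[OF M N B C f(1,2) that] .
  have G: "coset_map M B g (C +>\<^bsub>N\<^esub> x) = B +>\<^bsub>M\<^esub> g x" if "x \<in> carrier N" for x
    using coset_map_coset[OF N M C B g(1,2) that] .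
  have "bij_betw (coset_map N C f) (carrier (subquotient M Z B)) (carrier (subquotient N W C))"
  proof (rule bij_betwI[of _ _ _ "coset_map M B g"])
    show "coset_map M B g (coset_map N C f X) = X" if X: "X \<in> carrier (subquotient M Z B)" for X
    proof -
      obtain x where "x \<in> Z" "X = B +>\<^bsub>M\<^esub> x" using X by (auto simp: subquotient_carrier_iff)
      moreover from this have "x \<in> carrier M" "f x \<in> carrier N" using Z f(3) W by auto
      ultimately show ?thesis by (simp add: F G gf)
    qed
    show "coset_map N C f (coset_map M B g Y) = Y" if Y: "Y \<in> carrier (subquotient N W C)" for Y
    proof -
      obtain x where "x \<in> W" "Y = C +>\<^bsub>N\<^esub> x" using Y by (auto simp: subquotient_carrier_iff)
      moreover from this have "x \<in> carrier N" "g x \<in> carrier M" using W g(3) Z by auto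
      ultimately show ?thesis by (simp add: F G fg)
    qed
  qed (use module_homD(1)[OF hom(1)] module_homD(1)[OF hom(2)] in auto)
  with hom(1) show ?thesis by (simp add: module_iso_def)
qed

section \<open>Submodules arising as kernels, images and sums\<close>

lemma submodule_a_kernel:
  assumes "module R M" "module R N" "f \<in> module_hom R M N"
  shows "submodule (a_kernel M N f) R M"
proof -
  interpret M: module R M by fact
  interpret N: module R N by fact
  show ?thesis
    by (rule M.submoduleI)
      (auto simp: a_kernel_def' module_homD[OF assms(3)] module_hom_zero[OF assms]
        module_hom_uminus[OF assms])
qed

lemma submodule_image:
  assumes "module R M" "module R N" "f \<in> module_hom R M N" "submodule H R M"
  shows "submodule (f ` H) R N"
proof -
  interpret M: module R M by fact
  interpret N: module R N by fact
  note H = M.submoduleE[OF assms(4)]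
  note HM = subsetD[OF H(1)]
  show ?thesis
  proof (rule N.submoduleI)
    show "\<zero>\<^bsub>N\<^esub> \<in> f ` H"
      using submodule_zero[OF assms(1,4)] module_hom_zero[OF assms(1-3)] by (metis imageI)
    show "f ` H \<subseteq> carrier N" using module_homD(1)[OF assms(3)] H(1) by auto
    fix y assume "y \<in> f ` H"
    then obtain x where x: "x \<in> H" "x \<in> carrier M" "y = f x" using HM by blast
    show "\<ominus>\<^bsub>N\<^esub> y \<in> f ` H"
      using imageI[OF H(3)[OF x(1)], of f] module_hom_uminus[OF assms(1-3) x(2)] x(3) by simp
    show "c \<odot>\<^bsub>N\<^esub> y \<in> f ` H" if "c \<in> carrier R" for c
      using imageI[OF H(4)[OF that x(1)], of f] module_homD(3)[OF assms(3) that x(2)] x(3) by simp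
    show "y \<oplus>\<^bsub>N\<^esub> z \<in> f ` H" if z: "z \<in> f ` H" for z
    proof -
      obtain x' where x': "x' \<in> H" "x' \<in> carrier M" "z = f x'" using z HM by blast
      show ?thesis
        using imageI[OF H(5)[OF x(1) x'(1)], of f] module_homD(2)[OF assms(3) x(2) x'(2)] x(3) x'(3)
        by simp
    qed
  qed
qed

lemma set_add_mem: "x \<in> H \<Longrightarrow> y \<in> K \<Longrightarrow> x \<oplus>\<^bsub>M\<^esub> y \<in> H <+>\<^bsub>M\<^esub> K"
  by (auto simp: set_add_def')

lemma submodule_set_add:
  assumes "module R M" "submodule H R M" "submodule K R M"
  shows "submodule (H <+>\<^bsub>M\<^esub> K) R M"
proof -
  interpret M: module R M by fact
  note H = M.submoduleE[OF assms(2)]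
  note K = M.submoduleE[OF assms(3)]
  note HM = subsetD[OF H(1)]
  note KM = subsetD[OF K(1)]
  have D: "\<exists>a b. a \<in> H \<and> b \<in> K \<and> x = a \<oplus>\<^bsub>M\<^esub> b" if "x \<in> H <+>\<^bsub>M\<^esub> K" for x
    using that by (auto simp: set_add_def')
  show ?thesis
  proof (rule M.submoduleI)
    show "H <+>\<^bsub>M\<^esub> K \<subseteq> carrier M" by (auto dest!: D intro: HM KM)
    show "\<zero>\<^bsub>M\<^esub> \<in> H <+>\<^bsub>M\<^esub> K"
      using set_add_mem[OF submodule_zero[OF assms(1,2)] submodule_zero[OF assms(1,3)], of M] by simp
  next
    fix x assume "x \<in> H <+>\<^bsub>M\<^esub> K"
    then obtain a b where x: "a \<in> H" "b \<in> K" "x = a \<oplus>\<^bsub>M\<^esub> b" using D by blast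
    show "\<ominus>\<^bsub>M\<^esub> x \<in> H <+>\<^bsub>M\<^esub> K"
      using set_add_mem[OF H(3)[OF x(1)] K(3)[OF x(2)], of M] x HM KM by (simp add: M.minus_add)
    show "c \<odot>\<^bsub>M\<^esub> x \<in> H <+>\<^bsub>M\<^esub> K" if "c \<in> carrier R" for c
      using set_add_mem[OF H(4)[OF that x(1)] K(4)[OF that x(2)], of M] x HM KM that
      by (simp add: M.smult_r_distr)
    show "x \<oplus>\<^bsub>M\<^esub> y \<in> H <+>\<^bsub>M\<^esub> K" if y': "y \<in> H <+>\<^bsub>M\<^esub> K" for y
    proof -
      obtain a' b' where y: "a' \<in> H" "b' \<in> K" "y = a' \<oplus>\<^bsub>M\<^esub> b'" using D[OF y'] by blast
      have "x \<oplus>\<^bsub>M\<^esub> y = (a \<oplus>\<^bsub>M\<^esub> a') \<oplus>\<^bsub>M\<^esub> (b \<oplus>\<^bsub>M\<^esub> b')"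
        using x y HM KM by (simp add: M.a_ac)
      then show ?thesis using set_add_mem[OF H(5)[OF x(1) y(1)] K(5)[OF x(2) y(2)], of M] by simp
    qed
  qed
qed

section \<open>Spectral sequences of filtered complexes\<close>

locale filtered_module_complex =
  fixes R :: "'a ring" and K :: "('a, 'b) filtered_complex"
  assumes fc_module: "module R (fc_mod K n)"
    and fc_filt_submodule: "submodule (fc_filt K p n) R (fc_mod K n)"
    and fc_filt_mono: "p \<le> p' \<Longrightarrow> fc_filt K p n \<subseteq> fc_filt K p' n"
    and fc_diff_hom: "fc_diff K n \<in> module_hom R (fc_mod K n) (fc_mod K (n + 1))"
    and fc_diff_filt: "x \<in> fc_filt K p n \<Longrightarrow> fc_diff K n x \<in> fc_filt K p (n + 1)"
    and fc_diff_diff: "x \<in> carrier (fc_mod K n) \<Longrightarrow>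
      fc_diff K (n + 1) (fc_diff K n x) = \<zero>\<^bsub>fc_mod K (n + 1 + 1)\<^esub>"
begin

lemma fc_filt_carrier: "x \<in> fc_filt K p n \<Longrightarrow> x \<in> carrier (fc_mod K n)"
  using module.submoduleE(1)[OF fc_module fc_filt_submodule] by blast

lemma fc_filt_mem_mono: "x \<in> fc_filt K p n \<Longrightarrow> p \<le> p' \<Longrightarrow> x \<in> fc_filt K p' n"
  using fc_filt_mono by blast

lemma fc_diff_closed: "x \<in> carrier (fc_mod K n) \<Longrightarrow> fc_diff K n x \<in> carrier (fc_mod K (n + 1))"
  by (rule module_homD(1)[OF fc_diff_hom])

lemma submodule_cycles: "submodule (ss_cycles K r p n) R (fc_mod K n)"
proof -
  interpret module R "fc_mod K n" by (rule fc_module)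
  note F = submoduleE[OF fc_filt_submodule[of p n]]
  note G = module.submoduleE[OF fc_module fc_filt_submodule[of "p - r" "n + 1"]]
  note d = module_homD[OF fc_diff_hom[of n]]
  note d_uminus = module_hom_uminus[OF fc_module fc_module fc_diff_hom[of n]]
  have "fc_diff K n \<zero>\<^bsub>fc_mod K n\<^esub> \<in> fc_filt K (p - r) (n + 1)"
    using module_hom_zero[OF fc_module fc_module fc_diff_hom[of n]]
      submodule_zero[OF fc_module fc_filt_submodule[of "p - r" "n + 1"]] by simp
  then show ?thesis
    by (intro submoduleI)
      (auto simp: ss_cycles_def d d_uminus fc_filt_carrier intro: F(3-5) G(3-5) fc_filt_carrier
        submodule_zero[OF fc_module fc_filt_submodule])
qed

lemma cycles_carrier: "x \<in> ss_cycles K r p n \<Longrightarrow> x \<in> carrier (fc_mod K n)"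
  by (auto simp: ss_cycles_def intro: fc_filt_carrier)

lemma diff_hom_pred: "fc_diff K (n - 1) \<in> module_hom R (fc_mod K (n - 1)) (fc_mod K n)"
  using fc_diff_hom[of "n - 1"] by simp

lemma submodule_boundaries: "submodule (ss_boundaries K r p n) R (fc_mod K n)"
  unfolding ss_boundaries_def
  by (intro submodule_set_add submodule_image[OF _ _ diff_hom_pred] submodule_cycles fc_module)

lemma boundariesE:
  assumes "x \<in> ss_boundaries K r p n"
  obtains u v where "u \<in> ss_cycles K (r - 1) (p + r - 1) (n - 1)" "v \<in> ss_cycles K (r - 1) (p - 1) n"
    "x = fc_diff K (n - 1) u \<oplus>\<^bsub>fc_mod K n\<^esub> v"
  using assms by (auto simp: ss_boundaries_def set_add_def')

lemma diff_cycles: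
  assumes "x \<in> ss_cycles K r p n"
  shows "fc_diff K n x \<in> ss_cycles K r (p - r) (n + 1)"
  using assms fc_diff_diff[OF cycles_carrier[OF assms]]
  by (simp add: ss_cycles_def submodule_zero[OF fc_module fc_filt_submodule])

lemma cycles_boundaries:
  assumes "v \<in> ss_cycles K (r - 1) (p - 1) n"
  shows "v \<in> ss_boundaries K r p n"
proof -
  interpret module R "fc_mod K n" by (rule fc_module)
  have "fc_diff K (n - 1) \<zero>\<^bsub>fc_mod K (n - 1)\<^esub> \<oplus>\<^bsub>fc_mod K n\<^esub> v \<in> ss_boundaries K r p n"
    unfolding ss_boundaries_def
    by (intro set_add_mem imageI assms submodule_zero[OF fc_module submodule_cycles])
  then show ?thesis
    using module_hom_zero[OF fc_module fc_module diff_hom_pred[of n]] cycles_carrier[OF assms] by simp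
qed

lemma diff_cycles_boundaries:
  assumes "u \<in> ss_cycles K (r - 1) (p + r - 1) (n - 1)"
  shows "fc_diff K (n - 1) u \<in> ss_boundaries K r p n"
proof -
  interpret module R "fc_mod K n" by (rule fc_module)
  have "fc_diff K (n - 1) u \<oplus>\<^bsub>fc_mod K n\<^esub> \<zero>\<^bsub>fc_mod K n\<^esub> \<in> ss_boundaries K r p n"
    unfolding ss_boundaries_def
    by (intro set_add_mem imageI assms submodule_zero[OF fc_module submodule_cycles])
  then show ?thesis
    using module_homD(1)[OF diff_hom_pred] cycles_carrier[OF assms] by simp
qed

text \<open>The filtration indices fit: \<open>u\<close> in column p + r - 1 at level r - 1 has its
  differential in F_p, and \<open>v\<close> in column p - 1 at the same level has its differential
  in F_(p-r).\<close>

lemma boundaries_subset_cycles: "ss_boundaries K r p n \<subseteq> ss_cycles K r p n"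
proof
  fix x assume "x \<in> ss_boundaries K r p n"
  then obtain u v where u: "u \<in> ss_cycles K (r - 1) (p + r - 1) (n - 1)"
    and v: "v \<in> ss_cycles K (r - 1) (p - 1) n" and x: "x = fc_diff K (n - 1) u \<oplus>\<^bsub>fc_mod K n\<^esub> v"
    by (rule boundariesE)
  have "fc_diff K (n - 1) u \<in> ss_cycles K r p n"
    using u fc_diff_diff[OF cycles_carrier[OF u]]
    by (simp add: ss_cycles_def submodule_zero[OF fc_module fc_filt_submodule])
  moreover have "v \<in> ss_cycles K r p n"
    using v by (auto simp: ss_cycles_def intro: fc_filt_mem_mono)
  ultimately show "x \<in> ss_cycles K r p n"
    using module.submoduleE(5)[OF fc_module submodule_cycles] x by simp
qed

text \<open>The summand coming from \<open>u\<close> is killed by a second differential. Since p - 1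
  = (p - r) + r - 1, the remaining \<open>v\<close> has exactly the indices required of a primitive
  of a boundary in column p - r.\<close>

lemma diff_boundaries:
  assumes "x \<in> ss_boundaries K r p n"
  shows "fc_diff K n x \<in> ss_boundaries K r (p - r) (n + 1)"
proof -
  interpret module R "fc_mod K (n + 1)" by (rule fc_module)
  obtain u v where u: "u \<in> ss_cycles K (r - 1) (p + r - 1) (n - 1)"
    and v: "v \<in> ss_cycles K (r - 1) (p - 1) n" and x: "x = fc_diff K (n - 1) u \<oplus>\<^bsub>fc_mod K n\<^esub> v"
    using assms by (rule boundariesE)
  have "fc_diff K n x = fc_diff K n v"
    using x fc_diff_diff[OF cycles_carrier[OF u]] cycles_carrier[OF v]
      module_homD(1)[OF diff_hom_pred cycles_carrier[OF u]]
    by (simp add: module_homD(2)[OF fc_diff_hom] fc_diff_closed)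
  then show ?thesis
    using diff_cycles_boundaries[of v r "p - r" "n + 1"] v by simp
qed

section \<open>Pages, their differentials and representatives of kernel classes\<close>

lemma module_page: "module R (ss_page K r p q)"
  unfolding ss_page_def by (intro module_subquotient fc_module submodule_cycles submodule_boundaries)

lemma page_memI:
  "x \<in> ss_cycles K (int r) p (q - p) \<Longrightarrow>
    ss_boundaries K (int r) p (q - p) +>\<^bsub>fc_mod K (q - p)\<^esub> x \<in> carrier (ss_page K r p q)"
  by (auto simp: ss_page_def subquotient_carrier_iff)

lemma page_memE:
  assumes "X \<in> carrier (ss_page K r p q)"
  obtains x where "x \<in> ss_cycles K (int r) p (q - p)" "x \<in> carrier (fc_mod K (q - p))"
    "X = ss_boundaries K (int r) p (q - p) +>\<^bsub>fc_mod K (q - p)\<^esub> x"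
  using assms cycles_carrier by (auto simp: ss_page_def subquotient_carrier_iff)

lemma page_add:
  assumes "x \<in> carrier (fc_mod K (q - p))" "y \<in> carrier (fc_mod K (q - p))"
  shows "(ss_boundaries K (int r) p (q - p) +>\<^bsub>fc_mod K (q - p)\<^esub> x) \<oplus>\<^bsub>ss_page K r p q\<^esub>
      (ss_boundaries K (int r) p (q - p) +>\<^bsub>fc_mod K (q - p)\<^esub> y) =
    ss_boundaries K (int r) p (q - p) +>\<^bsub>fc_mod K (q - p)\<^esub> (x \<oplus>\<^bsub>fc_mod K (q - p)\<^esub> y)"
  unfolding ss_page_def by (rule subquotient_add[OF fc_module submodule_boundaries assms])

lemma page_coset_eq_zero_iff:
  assumes "x \<in> carrier (fc_mod K (q - p))"
  shows "ss_boundaries K (int r) p (q - p) +>\<^bsub>fc_mod K (q - p)\<^esub> x = \<zero>\<^bsub>ss_page K r p q\<^esub>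
    \<longleftrightarrow> x \<in> ss_boundaries K (int r) p (q - p)"
  unfolding ss_page_def by (rule coset_eq_zero_iff[OF fc_module submodule_boundaries assms])

lemma ss_diff_coset:
  assumes "x \<in> carrier (fc_mod K (q - p))"
  shows "ss_diff K r p q (ss_boundaries K (int r) p (q - p) +>\<^bsub>fc_mod K (q - p)\<^esub> x) =
    ss_boundaries K (int r) (p - int r) (q - p + 1) +>\<^bsub>fc_mod K (q - p + 1)\<^esub> fc_diff K (q - p) x"
  unfolding ss_diff_def
  by (rule coset_map_coset[OF fc_module fc_module submodule_boundaries submodule_boundaries
        fc_diff_hom _ assms]) (auto intro: diff_boundaries)

lemma ss_diff_hom:
  "ss_diff K r p q \<in> module_hom R (ss_page K r p q) (ss_page K r (p - int r) (q - int r + 1))"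
proof -
  have eq: "q - int r + 1 - (p - int r) = q - p + 1" by simp
  show ?thesis
    unfolding ss_diff_def ss_page_def eq
    by (rule coset_map_module_hom[OF fc_module fc_module submodule_boundaries submodule_boundaries
          fc_diff_hom])
      (auto intro: diff_boundaries diff_cycles cycles_carrier)
qed

lemma ss_diff_hom_pred:
  "ss_diff K r (p + int r) (q + int r - 1) \<in>
    module_hom R (ss_page K r (p + int r) (q + int r - 1)) (ss_page K r p q)"
  using ss_diff_hom[of r "p + int r" "q + int r - 1"] by simp

lemma submodule_diff_image: "submodule (ss_diff_image K r p q) R (ss_page K r p q)"
  unfolding ss_diff_image_def
  by (intro submodule_image[OF module_page module_page ss_diff_hom_pred]
      module.carrier_is_submodule module_page)

text \<open>If \<delta>_r kills the class of \<open>y\<close>, then d y = d u + v with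
  \<open>v\<close> in F_(p-r-1) and \<open>u\<close> an element of column p - 1 at level r - 1. Such
  a \<open>u\<close> is a boundary on E_r, so y - u represents the same class and has differential
  \<open>v\<close>.\<close>

lemma ss_diff_kernel_rep:
  assumes "X \<in> ss_diff_kernel K r p q"
  obtains x where "x \<in> ss_cycles K (int r) p (q - p)"
    "X = ss_boundaries K (int r) p (q - p) +>\<^bsub>fc_mod K (q - p)\<^esub> x"
    "fc_diff K (q - p) x \<in> fc_filt K (p - int r - 1) (q - p + 1)"
proof -
  define n where "n = q - p"
  interpret M: module R "fc_mod K n" by (rule fc_module)
  interpret N: module R "fc_mod K (n + 1)" by (rule fc_module)
  have eq: "q - int r + 1 - (p - int r) = n + 1" by (simp add: n_def)
  obtain y where y: "y \<in> ss_cycles K (int r) p n" "y \<in> carrier (fc_mod K n)"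
    and X: "X = ss_boundaries K (int r) p n +>\<^bsub>fc_mod K n\<^esub> y"
    using assms unfolding ss_diff_kernel_def a_kernel_def' n_def by (auto elim: page_memE)
  have "ss_diff K r p q X = \<zero>\<^bsub>ss_page K r (p - int r) (q - int r + 1)\<^esub>"
    using assms unfolding ss_diff_kernel_def a_kernel_def' by auto
  then have "ss_boundaries K (int r) (p - int r) (n + 1) +>\<^bsub>fc_mod K (n + 1)\<^esub> fc_diff K n y
      = \<zero>\<^bsub>ss_page K r (p - int r) (q - int r + 1)\<^esub>"
    using ss_diff_coset[of y q p r] y X by (simp add: n_def)
  then have "fc_diff K n y \<in> ss_boundaries K (int r) (p - int r) (n + 1)"
    using page_coset_eq_zero_iff[of "fc_diff K n y" "q - int r + 1" "p - int r" r] y(2)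
    by (simp only: eq fc_diff_closed simp_thms)
  then obtain u v where u: "u \<in> ss_cycles K (int r - 1) (p - 1) n"
    and v: "v \<in> ss_cycles K (int r - 1) (p - int r - 1) (n + 1)"
    and dy: "fc_diff K n y = fc_diff K n u \<oplus>\<^bsub>fc_mod K (n + 1)\<^esub> v"
    by (auto elim: boundariesE)
  define x where "x = y \<ominus>\<^bsub>fc_mod K n\<^esub> u"
  have uc: "u \<in> carrier (fc_mod K n)" and vc: "v \<in> carrier (fc_mod K (n + 1))"
    using u v by (auto intro: cycles_carrier)
  have uB: "u \<in> ss_boundaries K (int r) p n" by (rule cycles_boundaries[OF u])
  have xc: "x \<in> carrier (fc_mod K n)" using y(2) uc by (simp add: x_def)
  have "fc_diff K n x = v"
    using y(2) uc vc dy fc_diff_closed[OF uc] N.minus_eqI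
    by (simp add: x_def module_hom_minus[OF fc_module fc_module fc_diff_hom])
  then have "fc_diff K n x \<in> fc_filt K (p - int r - 1) (n + 1)"
    using v by (simp add: ss_cycles_def)
  moreover have "x \<in> ss_cycles K (int r) p n"
    unfolding x_def using uB boundaries_subset_cycles
    by (intro submodule_minus[OF fc_module submodule_cycles y(1)]) auto
  moreover have "y \<ominus>\<^bsub>fc_mod K n\<^esub> x = u"
    using y(2) uc by (intro M.minus_eqI) (simp_all add: x_def a_minus_def M.a_assoc M.l_neg)
  then have "X = ss_boundaries K (int r) p n +>\<^bsub>fc_mod K n\<^esub> x"
    using coset_eq_iff[OF fc_module submodule_boundaries y(2) xc] X uB by simp
  ultimately show thesis using that unfolding n_def by blast
qed

text \<open>For \<open>x\<close> representing a class in the kernel of \<open>\<delta>\<^sub>r\<close> with \<open>d x \<in> F\<^sub>p\<^sub>-\<^sub>r\<^sub>-\<^sub>1\<close>, the term \<open>h d x\<close>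
  lies in \<open>F\<^sub>p\<^sub>-\<^sub>1\<close> and is killed on the page, while \<open>d h x\<close> represents \<open>\<delta>\<^sub>r\<close> of the class of \<open>h x\<close>.\<close>

lemma ss_diff_kernel_homotopy:
  assumes h: "\<And>p n x. x \<in> fc_filt K p n \<Longrightarrow> h n x \<in> fc_filt K (p + int r) (n - 1)"
    and \<theta>: "\<And>p n x. x \<in> fc_filt K p n \<Longrightarrow> \<theta> n x \<in> fc_filt K p n"
    and htpy: "\<And>n x. x \<in> carrier (fc_mod K n) \<Longrightarrow>
      x = \<theta> n x \<oplus>\<^bsub>fc_mod K n\<^esub> (fc_diff K (n - 1) (h n x) \<oplus>\<^bsub>fc_mod K n\<^esub> h (n + 1) (fc_diff K n x))"
    and X: "X \<in> ss_diff_kernel K r p q"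
  obtains x w where "x \<in> ss_cycles K (int r) p (q - p)" "w \<in> ss_diff_image K r p q"
    "X = ss_boundaries K (int r) p (q - p) +>\<^bsub>fc_mod K (q - p)\<^esub> x"
    "X = (ss_boundaries K (int r) p (q - p) +>\<^bsub>fc_mod K (q - p)\<^esub> \<theta> (q - p) x) \<oplus>\<^bsub>ss_page K r p q\<^esub> w"
proof -
  define n where "n = q - p"
  interpret M: module R "fc_mod K n" by (rule fc_module)
  interpret N: module R "fc_mod K (n + 1)" by (rule fc_module)
  obtain x where x: "x \<in> ss_cycles K (int r) p n"
    "X = ss_boundaries K (int r) p n +>\<^bsub>fc_mod K n\<^esub> x"
    "fc_diff K n x \<in> fc_filt K (p - int r - 1) (n + 1)"
    using ss_diff_kernel_rep[OF X] unfolding n_def by metis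
  define y z where "y = h n x" and "z = h (n + 1) (fc_diff K n x)"
  have xF: "x \<in> fc_filt K p n" and xc: "x \<in> carrier (fc_mod K n)"
    using x(1) by (auto simp: ss_cycles_def intro: fc_filt_carrier)
  have \<theta>x: "\<theta> n x \<in> fc_filt K p n" by (rule \<theta>[OF xF])
  have \<theta>c: "\<theta> n x \<in> carrier (fc_mod K n)" by (rule fc_filt_carrier[OF \<theta>x])
  have y: "y \<in> fc_filt K (p + int r) (n - 1)" unfolding y_def by (rule h[OF xF])
  have z: "z \<in> fc_filt K (p - 1) n" using h[OF x(3)] by (simp add: z_def)
  have zc: "z \<in> carrier (fc_mod K n)" by (rule fc_filt_carrier[OF z])
  have dyc: "fc_diff K (n - 1) y \<in> carrier (fc_mod K n)"
    by (rule module_homD(1)[OF diff_hom_pred fc_filt_carrier[OF y]])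
  have eq: "x = \<theta> n x \<oplus>\<^bsub>fc_mod K n\<^esub> (fc_diff K (n - 1) y \<oplus>\<^bsub>fc_mod K n\<^esub> z)"
    unfolding y_def z_def by (rule htpy[OF xc])

  \<comment> \<open>That \<open>z\<close> lies in F_(p-1) does not yet make it vanish on E_r; d z
    must also lie in F_(p-r). Since \<open>z\<close> is h of u = d x, the homotopy identity at
    \<open>u\<close> expresses d z through \<open>u\<close>, \<theta> u and h d u, whose filtrations
    are known.\<close>
  define u where "u = fc_diff K n x"
  have u: "u \<in> fc_filt K (p - int r - 1) (n + 1)" and uc: "u \<in> carrier (fc_mod K (n + 1))"
    using x(3) by (auto simp: u_def intro: fc_filt_carrier)
  have "fc_diff K (n + 1) u = \<zero>\<^bsub>fc_mod K (n + 1 + 1)\<^esub>" unfolding u_def by (rule fc_diff_diff[OF xc])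
  \<comment> \<open>Only the filtration bound on \<open>h\<close> is available, so the value at zero
    is controlled by regarding zero as an element of F_(p-2r).\<close>
  moreover have "h (n + 1 + 1) \<zero>\<^bsub>fc_mod K (n + 1 + 1)\<^esub> \<in> fc_filt K (p - int r) (n + 1)"
    using h[OF submodule_zero[OF fc_module fc_filt_submodule[of "p - int r - int r" "n + 1 + 1"]]]
    by (simp add: add.commute)
  ultimately have hdu: "h (n + 1 + 1) (fc_diff K (n + 1) u) \<in> fc_filt K (p - int r) (n + 1)" by simp
  have \<theta>u: "\<theta> (n + 1) u \<in> fc_filt K (p - int r) (n + 1)"
    using \<theta>[OF u] by (rule fc_filt_mem_mono) simp
  have uF: "u \<in> fc_filt K (p - int r) (n + 1)" using u by (rule fc_filt_mem_mono) simp
  have dzc: "fc_diff K n z \<in> carrier (fc_mod K (n + 1))" by (rule fc_diff_closed[OF zc])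
  have "u = \<theta> (n + 1) u \<oplus>\<^bsub>fc_mod K (n + 1)\<^esub>
      (fc_diff K n z \<oplus>\<^bsub>fc_mod K (n + 1)\<^esub> h (n + 1 + 1) (fc_diff K (n + 1) u))"
    using htpy[OF uc] by (simp add: z_def u_def)
  then have "fc_diff K n z = (u \<ominus>\<^bsub>fc_mod K (n + 1)\<^esub> \<theta> (n + 1) u) \<ominus>\<^bsub>fc_mod K (n + 1)\<^esub>
      h (n + 1 + 1) (fc_diff K (n + 1) u)"
    using uc dzc fc_filt_carrier[OF hdu] fc_filt_carrier[OF \<theta>u]
    by (intro N.minus_minus_eqI[symmetric])
  also have "\<dots> \<in> fc_filt K (p - int r) (n + 1)"
    by (intro submodule_minus[OF fc_module fc_filt_submodule] uF \<theta>u hdu)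
  finally have dz: "fc_diff K n z \<in> fc_filt K (p - int r) (n + 1)" .

  have zB: "z \<in> ss_boundaries K (int r) p n"
    using z dz by (intro cycles_boundaries) (simp add: ss_cycles_def)
  \<comment> \<open>A priori \<open>y\<close> only lies in F_(p+r). Solving the homotopy identity
    for d y places d y in F_p, so \<open>y\<close> is an r-cycle in column p + r and its class is in
    the domain of \<delta>_r.\<close>
  have "z \<in> fc_filt K p n" using z by (rule fc_filt_mem_mono) simp
  moreover have "fc_diff K (n - 1) y = (x \<ominus>\<^bsub>fc_mod K n\<^esub> \<theta> n x) \<ominus>\<^bsub>fc_mod K n\<^esub> z"
    by (rule M.minus_minus_eqI[OF eq \<theta>c dyc zc, symmetric])
  ultimately have "fc_diff K (n - 1) y \<in> fc_filt K p n"
    by (metis submodule_minus[OF fc_module fc_filt_submodule] xF \<theta>x)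
  then have yZ: "y \<in> ss_cycles K (int r) (p + int r) (n - 1)"
    using y by (simp add: ss_cycles_def)

  define B where "B = ss_boundaries K (int r) p n"
  define w where "w = B +>\<^bsub>fc_mod K n\<^esub> fc_diff K (n - 1) y"
  have n1: "q + int r - 1 - (p + int r) = n - 1" by (simp add: n_def)
  have "w = ss_diff K r (p + int r) (q + int r - 1)
      (ss_boundaries K (int r) (p + int r) (n - 1) +>\<^bsub>fc_mod K (n - 1)\<^esub> y)"
    using ss_diff_coset[of y "q + int r - 1" "p + int r" r] cycles_carrier[OF yZ]
    by (simp add: n1 w_def B_def)
  then have "w \<in> ss_diff_image K r p q"
    using page_memI[of y r "p + int r" "q + int r - 1"] yZ
    unfolding ss_diff_image_def n1 by blast
  moreover have "X = (B +>\<^bsub>fc_mod K n\<^esub> \<theta> n x) \<oplus>\<^bsub>ss_page K r p q\<^esub> w"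
  proof -
    have "x \<ominus>\<^bsub>fc_mod K n\<^esub> (\<theta> n x \<oplus>\<^bsub>fc_mod K n\<^esub> fc_diff K (n - 1) y) = z"
      using eq dyc zc \<theta>c by (intro M.minus_eqI) (simp_all add: M.a_assoc)
    then have "B +>\<^bsub>fc_mod K n\<^esub> x = B +>\<^bsub>fc_mod K n\<^esub> (\<theta> n x \<oplus>\<^bsub>fc_mod K n\<^esub> fc_diff K (n - 1) y)"
      using zB coset_eq_iff[OF fc_module submodule_boundaries xc] dyc \<theta>c by (simp add: B_def)
    then show ?thesis
      using x(2) page_add[of "\<theta> n x" q p "fc_diff K (n - 1) y" r] dyc \<theta>c
      by (simp add: B_def n_def w_def)
  qed
  ultimately show thesis using that x unfolding n_def B_def by blast
qed

end

section \<open>Filtered chain maps and homotopies on pages\<close>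

locale filtered_map = K: filtered_module_complex R K + L: filtered_module_complex R L
  for R :: "'a ring" and K :: "('a, 'b) filtered_complex" and L :: "('a, 'c) filtered_complex" +
  fixes \<phi> :: "int \<Rightarrow> 'b \<Rightarrow> 'c"
  assumes map_hom: "\<phi> n \<in> module_hom R (fc_mod K n) (fc_mod L n)"
    and map_filt: "x \<in> fc_filt K p n \<Longrightarrow> \<phi> n x \<in> fc_filt L p n"
    and map_diff: "x \<in> carrier (fc_mod K n) \<Longrightarrow> \<phi> (n + 1) (fc_diff K n x) = fc_diff L n (\<phi> n x)"
begin

lemma map_closed: "x \<in> carrier (fc_mod K n) \<Longrightarrow> \<phi> n x \<in> carrier (fc_mod L n)"
  by (rule module_homD(1)[OF map_hom])

lemma map_cycles:
  assumes "x \<in> ss_cycles K r p n"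
  shows "\<phi> n x \<in> ss_cycles L r p n"
  using assms map_filt map_diff[OF K.cycles_carrier[OF assms]]
  by (auto simp: ss_cycles_def simp flip: map_diff[OF K.cycles_carrier[OF assms]])

lemma map_boundaries:
  assumes "x \<in> ss_boundaries K r p n"
  shows "\<phi> n x \<in> ss_boundaries L r p n"
proof -
  obtain u v where u: "u \<in> ss_cycles K (r - 1) (p + r - 1) (n - 1)"
    and v: "v \<in> ss_cycles K (r - 1) (p - 1) n" and x: "x = fc_diff K (n - 1) u \<oplus>\<^bsub>fc_mod K n\<^esub> v"
    using assms by (rule K.boundariesE)
  have "\<phi> n x = \<phi> n (fc_diff K (n - 1) u) \<oplus>\<^bsub>fc_mod L n\<^esub> \<phi> n v"
    unfolding x using K.cycles_carrier[OF u] K.cycles_carrier[OF v]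
    by (intro module_homD(2)[OF map_hom] module_homD(1)[OF K.diff_hom_pred])
  also have "\<phi> n (fc_diff K (n - 1) u) = fc_diff L (n - 1) (\<phi> (n - 1) u)"
    using map_diff[OF K.cycles_carrier[OF u]] by simp
  finally have "\<phi> n x = fc_diff L (n - 1) (\<phi> (n - 1) u) \<oplus>\<^bsub>fc_mod L n\<^esub> \<phi> n v" .
  also have "\<dots> \<in> ss_boundaries L r p n"
    unfolding ss_boundaries_def by (intro set_add_mem imageI map_cycles u v)
  finally show ?thesis .
qed

lemma page_map_coset:
  assumes "x \<in> carrier (fc_mod K (q - p))"
  shows "ss_page_map L \<phi> r p q (ss_boundaries K (int r) p (q - p) +>\<^bsub>fc_mod K (q - p)\<^esub> x) =
    ss_boundaries L (int r) p (q - p) +>\<^bsub>fc_mod L (q - p)\<^esub> \<phi> (q - p) x"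
  unfolding ss_page_map_def
  by (rule coset_map_coset[OF K.fc_module L.fc_module K.submodule_boundaries L.submodule_boundaries
        map_hom _ assms]) (auto intro: map_boundaries)

lemma page_map_hom: "ss_page_map L \<phi> r p q \<in> module_hom R (ss_page K r p q) (ss_page L r p q)"
  unfolding ss_page_map_def ss_page_def
  by (rule coset_map_module_hom[OF K.fc_module L.fc_module K.submodule_boundaries
        L.submodule_boundaries map_hom])
    (auto intro: map_boundaries map_cycles K.cycles_carrier)

lemma page_map_diff:
  assumes "X \<in> carrier (ss_page K r p q)"
  shows "ss_page_map L \<phi> r (p - int r) (q - int r + 1) (ss_diff K r p q X) =
    ss_diff L r p q (ss_page_map L \<phi> r p q X)"
proof -
  have eq: "q - int r + 1 - (p - int r) = q - p + 1" by simp
  obtain x where x: "x \<in> carrier (fc_mod K (q - p))"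
    "X = ss_boundaries K (int r) p (q - p) +>\<^bsub>fc_mod K (q - p)\<^esub> x"
    using assms by (rule K.page_memE)
  show ?thesis
    using page_map_coset[of "fc_diff K (q - p) x" "q - int r + 1" "p - int r" r, unfolded eq]
    by (simp add: x K.ss_diff_coset L.ss_diff_coset page_map_coset map_closed K.fc_diff_closed map_diff)
qed

lemma page_map_kernel:
  "ss_page_map L \<phi> r p q ` ss_diff_kernel K r p q \<subseteq> ss_diff_kernel L r p q"
proof
  fix Y assume "Y \<in> ss_page_map L \<phi> r p q ` ss_diff_kernel K r p q"
  then obtain X where X: "X \<in> carrier (ss_page K r p q)" "Y = ss_page_map L \<phi> r p q X"
    and dX: "ss_diff K r p q X = \<zero>\<^bsub>ss_page K r (p - int r) (q - int r + 1)\<^esub>"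
    by (auto simp: ss_diff_kernel_def a_kernel_def')
  have "ss_diff L r p q Y = \<zero>\<^bsub>ss_page L r (p - int r) (q - int r + 1)\<^esub>"
    using page_map_diff[OF X(1)] dX X(2)
    by (simp add: module_hom_zero[OF K.module_page L.module_page page_map_hom])
  then show "Y \<in> ss_diff_kernel L r p q"
    using module_homD(1)[OF page_map_hom X(1)] X(2) by (simp add: ss_diff_kernel_def a_kernel_def')
qed

lemma page_map_image:
  "ss_page_map L \<phi> r p q ` ss_diff_image K r p q \<subseteq> ss_diff_image L r p q"
proof -
  have "ss_page_map L \<phi> r p q (ss_diff K r (p + int r) (q + int r - 1) X) \<in> ss_diff_image L r p q"
    if X: "X \<in> carrier (ss_page K r (p + int r) (q + int r - 1))" for X
    using page_map_diff[OF X] module_homD(1)[OF page_map_hom X] by (simp add: ss_diff_image_def)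
  then show ?thesis unfolding ss_diff_image_def[of K] by blast
qed

end

text \<open>With \<theta> the composite of \<phi> and \<psi>, the decomposition of a kernel class
  writes \<open>X\<close> as its image under the composite plus an element of the image of
  \<delta>_r, and homology divides out the latter.\<close>

lemma page_map_homotopy_inverse:
  assumes "filtered_map R K L \<phi>" "filtered_map R L K \<psi>"
    and h: "\<And>p n x. x \<in> fc_filt K p n \<Longrightarrow> h n x \<in> fc_filt K (p + int r) (n - 1)"
    and htpy: "\<And>n x. x \<in> carrier (fc_mod K n) \<Longrightarrow> x = \<psi> n (\<phi> n x) \<oplus>\<^bsub>fc_mod K n\<^esub>
      (fc_diff K (n - 1) (h n x) \<oplus>\<^bsub>fc_mod K n\<^esub> h (n + 1) (fc_diff K n x))"
    and X: "X \<in> ss_diff_kernel K r p q"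
  shows "ss_diff_image K r p q +>\<^bsub>ss_page K r p q\<^esub>
      ss_page_map K \<psi> r p q (ss_page_map L \<phi> r p q X) =
    ss_diff_image K r p q +>\<^bsub>ss_page K r p q\<^esub> X"
proof -
  interpret f: filtered_map R K L \<phi> by fact
  interpret g: filtered_map R L K \<psi> by fact
  interpret P: module R "ss_page K r p q" by (rule f.K.module_page)
  let ?gf = "ss_page_map K \<psi> r p q (ss_page_map L \<phi> r p q X)"
  obtain x w where x: "x \<in> ss_cycles K (int r) p (q - p)" and w: "w \<in> ss_diff_image K r p q"
    and X1: "X = ss_boundaries K (int r) p (q - p) +>\<^bsub>fc_mod K (q - p)\<^esub> x"
    and X2: "X = (ss_boundaries K (int r) p (q - p) +>\<^bsub>fc_mod K (q - p)\<^esub> \<psi> (q - p) (\<phi> (q - p) x))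
      \<oplus>\<^bsub>ss_page K r p q\<^esub> w"
    using f.K.ss_diff_kernel_homotopy[of h r "\<lambda>n x. \<psi> n (\<phi> n x)" X p q, OF h _ htpy X]
      f.map_filt g.map_filt by blast
  have gf: "?gf = ss_boundaries K (int r) p (q - p) +>\<^bsub>fc_mod K (q - p)\<^esub> \<psi> (q - p) (\<phi> (q - p) x)"
    using f.K.cycles_carrier[OF x]
    by (simp add: X1 f.page_map_coset g.page_map_coset f.map_closed)
  have "x \<in> carrier (fc_mod K (q - p))" by (rule f.K.cycles_carrier[OF x])
  have Xc: "X \<in> carrier (ss_page K r p q)" using f.K.page_memI[OF x] X1 by simp
  then have gfc: "?gf \<in> carrier (ss_page K r p q)"
    by (intro module_homD(1)[OF f.page_map_hom] module_homD(1)[OF g.page_map_hom])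
  have wc: "w \<in> carrier (ss_page K r p q)"
    using w P.submoduleE(1)[OF f.K.submodule_diff_image] by blast
  have "X \<ominus>\<^bsub>ss_page K r p q\<^esub> ?gf = w"
    using X2 gf gfc wc by (intro P.minus_eqI) simp_all
  then show ?thesis
    using coset_eq_iff[OF P.module_axioms f.K.submodule_diff_image Xc gfc] w by simp
qed

text \<open>The two homotopies make the maps induced by \<phi> and \<psi> mutually inverse on
  homology classes. Signs and infinite totals are confined to verifying the hypotheses for
  \<open>Tot\<close>.\<close>

theorem homotopy_equivalence_ss_homology_iso:
  assumes f: "filtered_map R K L \<phi>" and g: "filtered_map R L K \<psi>"
    and h: "\<And>p n x. x \<in> fc_filt K p n \<Longrightarrow> h n x \<in> fc_filt K (p + int r) (n - 1)"
    and h': "\<And>n x. x \<in> carrier (fc_mod K n) \<Longrightarrow> x = \<psi> n (\<phi> n x) \<oplus>\<^bsub>fc_mod K n\<^esub>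
      (fc_diff K (n - 1) (h n x) \<oplus>\<^bsub>fc_mod K n\<^esub> h (n + 1) (fc_diff K n x))"
    and k: "\<And>p n x. x \<in> fc_filt L p n \<Longrightarrow> k n x \<in> fc_filt L (p + int r) (n - 1)"
    and k': "\<And>n x. x \<in> carrier (fc_mod L n) \<Longrightarrow> x = \<phi> n (\<psi> n x) \<oplus>\<^bsub>fc_mod L n\<^esub>
      (fc_diff L (n - 1) (k n x) \<oplus>\<^bsub>fc_mod L n\<^esub> k (n + 1) (fc_diff L n x))"
  shows "ss_homology_map L \<phi> r p q \<in> module_iso R (ss_homology K r p q) (ss_homology L r p q)"
proof -
  interpret f: filtered_map R K L \<phi> by fact
  interpret g: filtered_map R L K \<psi> by fact
  show ?thesis
    unfolding ss_homology_map_def ss_homology_def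
  proof (rule coset_map_module_iso[OF f.K.module_page f.L.module_page f.K.submodule_diff_image
        f.L.submodule_diff_image f.page_map_hom f.page_map_image f.page_map_kernel
        g.page_map_hom g.page_map_image g.page_map_kernel])
    show "ss_diff_kernel K r p q \<subseteq> carrier (ss_page K r p q)"
      "ss_diff_kernel L r p q \<subseteq> carrier (ss_page L r p q)"
      by (auto simp: ss_diff_kernel_def a_kernel_def')
  qed (rule page_map_homotopy_inverse[OF f g h h'] page_map_homotopy_inverse[OF g f k k']; assumption)+
qed

section \<open>Lower triangular matrices of module homomorphisms\<close>

lemma (in abelian_monoid) finsum_swap:
  assumes "finite A" "finite B" "\<And>i j. i \<in> A \<Longrightarrow> j \<in> B \<Longrightarrow> f i j \<in> carrier G"
  shows "(\<Oplus>i\<in>A. \<Oplus>j\<in>B. f i j) = (\<Oplus>j\<in>B. \<Oplus>i\<in>A. f i j)"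
  using assms(1,3)
proof (induction A rule: finite_induct)
  case empty
  then show ?case by (simp add: finsum_zero)
next
  case (insert a A)
  have f: "(\<lambda>j. f a j) \<in> B \<rightarrow> carrier G" "(\<lambda>j. \<Oplus>i\<in>A. f i j) \<in> B \<rightarrow> carrier G"
    "(\<lambda>i. \<Oplus>j\<in>B. f i j) \<in> A \<rightarrow> carrier G" "(\<Oplus>j\<in>B. f a j) \<in> carrier G"
    using insert.prems by (auto intro!: finsum_closed)
  have "(\<Oplus>j\<in>B. \<Oplus>i\<in>insert a A. f i j) = (\<Oplus>j\<in>B. f a j \<oplus> (\<Oplus>i\<in>A. f i j))"
    using insert f by (intro finsum_cong') (auto intro!: finsum_insert)
  also have "\<dots> = (\<Oplus>j\<in>B. f a j) \<oplus> (\<Oplus>i\<in>A. \<Oplus>j\<in>B. f i j)"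
    using insert f by (simp add: finsum_addf)
  also have "\<dots> = (\<Oplus>i\<in>insert a A. \<Oplus>j\<in>B. f i j)"
    using insert f by (simp add: finsum_insert)
  finally show ?case by simp
qed

lemma module_hom_finsum:
  assumes "module R M" "module R N" "f \<in> module_hom R M N" "finite A" "g \<in> A \<rightarrow> carrier M"
  shows "f (finsum M g A) = finsum N (\<lambda>i. f (g i)) A"
  using assms(4,5)
proof (induction A rule: finite_induct)
  case empty
  interpret M: module R M by fact
  interpret N: module R N by fact
  show ?case using module_hom_zero[OF assms(1-3)] by simp
next
  case (insert a A)
  interpret M: module R M by fact
  interpret N: module R N by fact
  have g: "g \<in> A \<rightarrow> carrier M" "g a \<in> carrier M" using insert.prems by auto
  then have fg: "(\<lambda>i. f (g i)) \<in> A \<rightarrow> carrier N" "f (g a) \<in> carrier N"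
    using module_homD(1)[OF assms(3)] by auto
  show ?case
    using insert g fg module_homD(2)[OF assms(3)]
    by (simp add: M.finsum_insert N.finsum_insert M.finsum_closed)
qed

lemma msign_hom:
  fixes R :: "'a ring"
  shows "module R M \<Longrightarrow> msign M k \<in> module_hom R M M"
proof -
  assume "module R M"
  then interpret module R M .
  show ?thesis
    by (rule module_homI) (auto simp: msign_def M.minus_add smult_r_minus)
qed

lemma msign_closed:
  fixes R :: "'a ring"
  shows "module R M \<Longrightarrow> x \<in> carrier M \<Longrightarrow> msign M k x \<in> carrier M"
  by (rule module_homD(1)[OF msign_hom])

lemma msign_msign:
  "module R M \<Longrightarrow> x \<in> carrier M \<Longrightarrow> msign M a (msign M b x) = msign M (a + b) x"
  by (auto simp: msign_def abelian_group.minus_minus[OF module_abelian_group])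

lemma msign_parity: "even a = even b \<Longrightarrow> msign M a x = msign M b x"
  by (simp add: msign_def)

lemma module_hom_msign:
  assumes "module R M" "module R N" "f \<in> module_hom R M N" "x \<in> carrier M"
  shows "f (msign M k x) = msign N k (f x)"
  using module_hom_uminus[OF assms] by (simp add: msign_def)

lemma zero_module_hom: "module R M \<Longrightarrow> module R N \<Longrightarrow> (\<lambda>x. \<zero>\<^bsub>N\<^esub>) \<in> module_hom R M N"
proof -
  assume "module R M" "module R N"
  then interpret M: module R M + N: module R N by simp_all
  show ?thesis by (rule module_homI) auto
qed

lemma module_hom_compose:
  "f \<in> module_hom R M N \<Longrightarrow> g \<in> module_hom R N P \<Longrightarrow> (\<lambda>x. g (f x)) \<in> module_hom R M P"
  by (auto simp: module_hom_def Pi_iff)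

text \<open>The construction of \<open>tot_mod\<close> for an arbitrary family of modules. The total
  degree disappears from the notation, and the source and target of a matrix may be unrelated
  families.\<close>

definition family_tot :: "(int \<Rightarrow> ('a, 'b) module) \<Rightarrow> ('a, int \<Rightarrow> 'b) module" where
  "family_tot M =
    \<lparr>carrier = {a. (\<forall>i. a i \<in> carrier (M i)) \<and> finite {i. i > 0 \<and> a i \<noteq> \<zero>\<^bsub>M i\<^esub>}},
     mult = undefined,
     one = undefined,
     zero = (\<lambda>i. \<zero>\<^bsub>M i\<^esub>),
     add = (\<lambda>a b i. a i \<oplus>\<^bsub>M i\<^esub> b i),
     smult = (\<lambda>c a i. c \<odot>\<^bsub>M i\<^esub> a i)\<rparr>"

definition family_filt :: "(int \<Rightarrow> ('a, 'b) module) \<Rightarrow> int \<Rightarrow> (int \<Rightarrow> 'b) set" where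
  "family_filt M p = {a. (\<forall>i. a i \<in> carrier (M i)) \<and> (\<forall>i>p. a i = \<zero>\<^bsub>M i\<^esub>)}"

lemma family_filtD:
  assumes "a \<in> family_filt M p"
  shows "a i \<in> carrier (M i)" "i > p \<Longrightarrow> a i = \<zero>\<^bsub>M i\<^esub>"
  using assms by (auto simp: family_filt_def)

lemma family_filt_mono: "p \<le> p' \<Longrightarrow> family_filt M p \<subseteq> family_filt M p'"
  by (auto simp: family_filt_def)

text \<open>Having finitely many nonzero components in positive columns is the same as vanishing
  above some column. Hence every element comes with a bound \<open>p\<close>, and the sums defining
  matrix maps can be taken over finite intervals ending at \<open>p\<close>.\<close>

lemma carrier_family_tot:
  fixes M :: "int \<Rightarrow> ('a, 'b) module"
  shows "carrier (family_tot M) = (\<Union>p. family_filt M p)"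
proof -
  have "(\<exists>p. \<forall>i>p. a i = \<zero>\<^bsub>M i\<^esub>) \<longleftrightarrow> finite {i. i > 0 \<and> a i \<noteq> \<zero>\<^bsub>M i\<^esub>}" (is "_ \<longleftrightarrow> finite ?S")
    for a :: "int \<Rightarrow> 'b"
  proof
    assume "\<exists>p. \<forall>i>p. a i = \<zero>\<^bsub>M i\<^esub>"
    then obtain p where p: "\<And>i. i > p \<Longrightarrow> a i = \<zero>\<^bsub>M i\<^esub>" by blast
    have "?S \<subseteq> {0..p}" using p by (auto simp: not_less[symmetric])
    then show "finite ?S" by (rule finite_subset) simp
  next
    assume fin: "finite ?S"
    have "a i = \<zero>\<^bsub>M i\<^esub>" if "i > Max (insert 0 ?S)" for i
    proof (rule ccontr)
      assume "a i \<noteq> \<zero>\<^bsub>M i\<^esub>"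
      moreover have "i > 0" using that fin by simp
      ultimately have "i \<le> Max (insert 0 ?S)" using fin by (intro Max_ge) auto
      then show False using that by simp
    qed
    then show "\<exists>p. \<forall>i>p. a i = \<zero>\<^bsub>M i\<^esub>" by blast
  qed
  then show ?thesis by (auto simp: family_tot_def family_filt_def)
qed

text \<open>Raising the bound past a prescribed \<open>q\<close> gives two elements a common bound,
  or makes an index interval reach a chosen column.\<close>

lemma carrier_family_totE:
  assumes "a \<in> carrier (family_tot M)"
  obtains p where "a \<in> family_filt M p" "p \<ge> q"
proof -
  obtain p where "a \<in> family_filt M p" using assms by (auto simp: carrier_family_tot)
  then have "a \<in> family_filt M (max p q)" using family_filt_mono[of p "max p q" M] by auto
  then show thesis using that by simp
qed

lemma family_filt_subset: "family_filt M p \<subseteq> carrier (family_tot M)"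
  by (auto simp: carrier_family_tot)

lemma family_tot_simps:
  "(a \<oplus>\<^bsub>family_tot M\<^esub> b) i = a i \<oplus>\<^bsub>M i\<^esub> b i"
  "(c \<odot>\<^bsub>family_tot M\<^esub> a) i = c \<odot>\<^bsub>M i\<^esub> a i"
  "\<zero>\<^bsub>family_tot M\<^esub> i = \<zero>\<^bsub>M i\<^esub>"
  by (simp_all add: family_tot_def)

lemma family_filt_closed:
  assumes "\<And>i. module R (M i)"
  shows "\<zero>\<^bsub>family_tot M\<^esub> \<in> family_filt M p"
    and "a \<in> family_filt M p \<Longrightarrow> b \<in> family_filt M p \<Longrightarrow> a \<oplus>\<^bsub>family_tot M\<^esub> b \<in> family_filt M p"
    and "c \<in> carrier R \<Longrightarrow> a \<in> family_filt M p \<Longrightarrow> c \<odot>\<^bsub>family_tot M\<^esub> a \<in> family_filt M p"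
    and "a \<in> family_filt M p \<Longrightarrow> (\<lambda>i. \<ominus>\<^bsub>M i\<^esub> a i) \<in> family_filt M p"
proof -
  interpret M: module R "M i" for i by (rule assms)
  show "\<zero>\<^bsub>family_tot M\<^esub> \<in> family_filt M p"
    "a \<in> family_filt M p \<Longrightarrow> b \<in> family_filt M p \<Longrightarrow> a \<oplus>\<^bsub>family_tot M\<^esub> b \<in> family_filt M p"
    "c \<in> carrier R \<Longrightarrow> a \<in> family_filt M p \<Longrightarrow> c \<odot>\<^bsub>family_tot M\<^esub> a \<in> family_filt M p"
    "a \<in> family_filt M p \<Longrightarrow> (\<lambda>i. \<ominus>\<^bsub>M i\<^esub> a i) \<in> family_filt M p"
    by (auto simp: family_filt_def family_tot_simps)
qed

lemma module_family_tot:
  assumes "\<And>i. module R (M i)"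
  shows "module R (family_tot M)"
proof -
  interpret M: module R "M i" for i by (rule assms)
  note closed = family_filt_closed[of R M, OF assms]
  have c: "a i \<in> carrier (M i)" if "a \<in> carrier (family_tot M)" for a i
    using that by (auto simp: family_tot_def)
  have add: "a \<oplus>\<^bsub>family_tot M\<^esub> b \<in> carrier (family_tot M)"
    if a: "a \<in> carrier (family_tot M)" and b: "b \<in> carrier (family_tot M)" for a b
  proof -
    obtain p where p: "a \<in> family_filt M p" using a by (auto simp: carrier_family_tot)
    obtain p' where "b \<in> family_filt M p'" "p' \<ge> p" using b by (rule carrier_family_totE)
    then show ?thesis
      using closed(2)[of a p' b] p family_filt_mono[of p p' M] family_filt_subset[of M p'] by blast
  qed
  have "abelian_group (family_tot M)"
  proof (rule abelian_groupI)
    show "\<zero>\<^bsub>family_tot M\<^esub> \<in> carrier (family_tot M)"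
      using closed(1) family_filt_subset by blast
    fix a assume a: "a \<in> carrier (family_tot M)"
    show "\<exists>b\<in>carrier (family_tot M). b \<oplus>\<^bsub>family_tot M\<^esub> a = \<zero>\<^bsub>family_tot M\<^esub>"
    proof (rule bexI)
      show "(\<lambda>i. \<ominus>\<^bsub>M i\<^esub> a i) \<oplus>\<^bsub>family_tot M\<^esub> a = \<zero>\<^bsub>family_tot M\<^esub>"
        using c[OF a] by (auto simp: fun_eq_iff family_tot_simps M.M.l_neg)
      show "(\<lambda>i. \<ominus>\<^bsub>M i\<^esub> a i) \<in> carrier (family_tot M)"
        using a closed(4) by (auto simp: carrier_family_tot)
    qed
  qed (auto simp: fun_eq_iff family_tot_simps c M.M.a_ac intro: add)
  moreover have "x \<odot>\<^bsub>family_tot M\<^esub> a \<in> carrier (family_tot M)"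
    if "x \<in> carrier R" "a \<in> carrier (family_tot M)" for x a
    using that closed(3) by (auto simp: carrier_family_tot)
  ultimately show ?thesis
    by (intro moduleI M.R.cring_axioms)
      (auto simp: fun_eq_iff family_tot_simps c M.smult_l_distr M.smult_r_distr M.smult_assoc1)
qed

lemma uminus_family_tot:
  assumes "\<And>i. module R (M i)" "a \<in> carrier (family_tot M)"
  shows "\<ominus>\<^bsub>family_tot M\<^esub> a = (\<lambda>i. \<ominus>\<^bsub>M i\<^esub> a i)"
proof -
  interpret M: module R "M i" for i by (rule assms)
  interpret T: module R "family_tot M" by (rule module_family_tot[OF assms(1)])
  have b: "(\<lambda>i. \<ominus>\<^bsub>M i\<^esub> a i) \<in> carrier (family_tot M)"
    using assms(2) family_filt_closed(4)[of R M, OF assms(1)] by (auto simp: carrier_family_tot)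
  have "(\<lambda>i. \<ominus>\<^bsub>M i\<^esub> a i) \<oplus>\<^bsub>family_tot M\<^esub> a = \<zero>\<^bsub>family_tot M\<^esub>"
    using assms(2) by (auto simp: fun_eq_iff family_tot_simps M.M.l_neg family_tot_def)
  then show ?thesis using T.M.minus_equality[OF _ assms(2) b] by simp
qed

lemma submodule_family_filt:
  assumes "\<And>i. module R (M i)"
  shows "submodule (family_filt M p) R (family_tot M)"
proof -
  interpret T: module R "family_tot M" by (rule module_family_tot[OF assms])
  note closed = family_filt_closed[of R M, OF assms]
  have "\<ominus>\<^bsub>family_tot M\<^esub> a \<in> family_filt M p" if "a \<in> family_filt M p" for a
    using closed(4)[OF that] uminus_family_tot[of R M a, OF assms] that family_filt_subset[of M p]
    by auto
  then show ?thesis by (intro T.submoduleI closed family_filt_subset)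
qed

text \<open>The entry \<open>U i j\<close> maps \<open>M i\<close> to \<open>N j\<close>, and \<open>s\<close> bounds how far a matrix raises the filtration.\<close>

definition filtered_matrix ::
  "'a ring \<Rightarrow> int \<Rightarrow> (int \<Rightarrow> ('a, 'b) module) \<Rightarrow> (int \<Rightarrow> ('a, 'c) module) \<Rightarrow>
    (int \<Rightarrow> int \<Rightarrow> 'b \<Rightarrow> 'c) \<Rightarrow> bool" where
  "filtered_matrix R s M N U \<longleftrightarrow>
     (\<forall>i j. U i j \<in> module_hom R (M i) (N j)) \<and>
     (\<forall>i j. i + s < j \<longrightarrow> (\<forall>x\<in>carrier (M i). U i j x = \<zero>\<^bsub>N j\<^esub>))"

text \<open>\<open>finsum\<close> is zero over infinite sets, hence the restriction to nonzero
  components; with \<open>j \<le> i + s\<close> the index set is finite for elements of the total.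
  For s = 0 the substitution i = j + m yields the index sets of \<open>tot_diff\<close> and
  \<open>tot_map\<close>.\<close>

definition matrix_map ::
  "int \<Rightarrow> (int \<Rightarrow> ('a, 'b) module) \<Rightarrow> (int \<Rightarrow> ('a, 'c) module) \<Rightarrow>
    (int \<Rightarrow> int \<Rightarrow> 'b \<Rightarrow> 'c) \<Rightarrow> (int \<Rightarrow> 'b) \<Rightarrow> int \<Rightarrow> 'c" where
  "matrix_map s M N U a j = (\<Oplus>\<^bsub>N j\<^esub> i\<in>{i. j \<le> i + s \<and> a i \<noteq> \<zero>\<^bsub>M i\<^esub>}. U i j (a i))"

text \<open>The interval contains every intermediate column that can contribute: for k > i + s the
  entry of \<open>U\<close> vanishes, for k < j - t the entry of \<open>V\<close> does.\<close>

definition matrix_comp ::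
  "int \<Rightarrow> int \<Rightarrow> (int \<Rightarrow> ('a, 'd) module) \<Rightarrow> (int \<Rightarrow> int \<Rightarrow> 'c \<Rightarrow> 'd) \<Rightarrow>
    (int \<Rightarrow> int \<Rightarrow> 'b \<Rightarrow> 'c) \<Rightarrow> int \<Rightarrow> int \<Rightarrow> 'b \<Rightarrow> 'd" where
  "matrix_comp t s P V U i j x = (\<Oplus>\<^bsub>P j\<^esub> k\<in>{j - t..i + s}. V k j (U i k x))"

locale matrix =
  fixes R :: "'a ring" and s :: int
    and M :: "int \<Rightarrow> ('a, 'b) module" and N :: "int \<Rightarrow> ('a, 'c) module"
    and U :: "int \<Rightarrow> int \<Rightarrow> 'b \<Rightarrow> 'c"
  assumes source_module: "module R (M i)"
    and target_module: "module R (N j)"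
    and filtered_matrix: "filtered_matrix R s M N U"
begin

lemma entry_hom: "U i j \<in> module_hom R (M i) (N j)"
  using filtered_matrix by (simp add: filtered_matrix_def)

lemma entry_closed: "x \<in> carrier (M i) \<Longrightarrow> U i j x \<in> carrier (N j)"
  by (rule module_homD(1)[OF entry_hom])

lemma entry_zero: "U i j \<zero>\<^bsub>M i\<^esub> = \<zero>\<^bsub>N j\<^esub>"
  by (rule module_hom_zero[OF source_module target_module entry_hom])

lemma entry_above: "i + s < j \<Longrightarrow> x \<in> carrier (M i) \<Longrightarrow> U i j x = \<zero>\<^bsub>N j\<^esub>"
  using filtered_matrix by (simp add: filtered_matrix_def)

text \<open>Outside the interval from j - s to p, either the entry or the component of
  \<open>a\<close> is zero. The free choice of \<open>S\<close> allows sums for different elements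
  or matrices to share one index set.\<close>

lemma matrix_map_eq:
  assumes a: "a \<in> family_filt M p" and S: "finite S" "{j - s..p} \<subseteq> S"
  shows "matrix_map s M N U a j = (\<Oplus>\<^bsub>N j\<^esub> i\<in>S. U i j (a i))"
proof -
  interpret N: module R "N j" by (rule target_module)
  show ?thesis
    unfolding matrix_map_def
  proof (rule N.M.add.finprod_mono_neutral_cong_left[folded finsum_def])
    show "{i. j \<le> i + s \<and> a i \<noteq> \<zero>\<^bsub>M i\<^esub>} \<subseteq> S"
      using family_filtD(2)[OF a] S(2) by (force simp: not_less[symmetric])
    fix i assume "i \<in> S - {i. j \<le> i + s \<and> a i \<noteq> \<zero>\<^bsub>M i\<^esub>}"
    then have "i + s < j \<or> a i = \<zero>\<^bsub>M i\<^esub>" by auto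
    then show "U i j (a i) = \<zero>\<^bsub>N j\<^esub>"
      using entry_above[OF _ family_filtD(1)[OF a]] entry_zero[of i j] by auto
  qed (use S(1) entry_closed family_filtD(1)[OF a] in auto)
qed

lemma matrix_map_filt:
  assumes "a \<in> family_filt M p"
  shows "matrix_map s M N U a \<in> family_filt N (p + s)"
proof -
  interpret N: module R "N j" for j by (rule target_module)
  have "matrix_map s M N U a j = (\<Oplus>\<^bsub>N j\<^esub> i\<in>{j - s..p}. U i j (a i))" for j
    by (rule matrix_map_eq[OF assms]) auto
  then show ?thesis
    using assms by (auto simp: family_filt_def entry_closed intro!: N.M.finsum_closed)
qed

lemma matrix_map_hom: "matrix_map s M N U \<in> module_hom R (family_tot M) (family_tot N)"
proof (rule module_homI)
  interpret N: module R "N j" for j by (rule target_module)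
  interpret T: module R "family_tot M" by (rule module_family_tot[OF source_module])
  fix a assume a: "a \<in> carrier (family_tot M)"
  then obtain p where p: "a \<in> family_filt M p" by (auto simp: carrier_family_tot)
  show "matrix_map s M N U a \<in> carrier (family_tot N)"
    using matrix_map_filt[OF p] family_filt_subset by blast
  show "matrix_map s M N U (c \<odot>\<^bsub>family_tot M\<^esub> a) = c \<odot>\<^bsub>family_tot N\<^esub> matrix_map s M N U a"
    if c: "c \<in> carrier R" for c
  proof
    fix j
    have ca: "c \<odot>\<^bsub>family_tot M\<^esub> a \<in> family_filt M p"
      by (rule family_filt_closed(3)[OF source_module c p])
    have "matrix_map s M N U (c \<odot>\<^bsub>family_tot M\<^esub> a) j
        = (\<Oplus>\<^bsub>N j\<^esub> i\<in>{j - s..p}. U i j ((c \<odot>\<^bsub>family_tot M\<^esub> a) i))"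
      by (rule matrix_map_eq[OF ca]) auto
    also have "\<dots> = (\<Oplus>\<^bsub>N j\<^esub> i\<in>{j - s..p}. c \<odot>\<^bsub>N j\<^esub> U i j (a i))"
      using family_filtD(1)[OF p] c
      by (intro N.M.finsum_cong') (auto simp: family_tot_simps module_homD(3)[OF entry_hom] entry_closed)
    also have "\<dots> = c \<odot>\<^bsub>N j\<^esub> (\<Oplus>\<^bsub>N j\<^esub> i\<in>{j - s..p}. U i j (a i))"
      using family_filtD(1)[OF p] c by (intro N.finsum_smult_ldistr[symmetric]) (auto simp: entry_closed)
    also have "(\<Oplus>\<^bsub>N j\<^esub> i\<in>{j - s..p}. U i j (a i)) = matrix_map s M N U a j"
      by (rule matrix_map_eq[OF p, symmetric]) auto
    also have "c \<odot>\<^bsub>N j\<^esub> matrix_map s M N U a j = (c \<odot>\<^bsub>family_tot N\<^esub> matrix_map s M N U a) j"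
      by (rule family_tot_simps(2)[symmetric])
    finally show "matrix_map s M N U (c \<odot>\<^bsub>family_tot M\<^esub> a) j = (c \<odot>\<^bsub>family_tot N\<^esub> matrix_map s M N U a) j" .
  qed
  show "matrix_map s M N U (a \<oplus>\<^bsub>family_tot M\<^esub> b) =
      matrix_map s M N U a \<oplus>\<^bsub>family_tot N\<^esub> matrix_map s M N U b"
    if "b \<in> carrier (family_tot M)" for b
  proof
    fix j
    obtain p' where b: "b \<in> family_filt M p'" and "p' \<ge> p"
      using \<open>b \<in> carrier (family_tot M)\<close> by (rule carrier_family_totE)
    then have a': "a \<in> family_filt M p'" using p family_filt_mono by blast
    have ab: "a \<oplus>\<^bsub>family_tot M\<^esub> b \<in> family_filt M p'"
      by (rule family_filt_closed(2)[OF source_module a' b])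
    have "matrix_map s M N U (a \<oplus>\<^bsub>family_tot M\<^esub> b) j
        = (\<Oplus>\<^bsub>N j\<^esub> i\<in>{j - s..p'}. U i j ((a \<oplus>\<^bsub>family_tot M\<^esub> b) i))"
      by (rule matrix_map_eq[OF ab]) auto
    also have "\<dots> = (\<Oplus>\<^bsub>N j\<^esub> i\<in>{j - s..p'}. U i j (a i) \<oplus>\<^bsub>N j\<^esub> U i j (b i))"
      using family_filtD(1)[OF a'] family_filtD(1)[OF b]
      by (intro N.M.finsum_cong') (auto simp: family_tot_simps module_homD(2)[OF entry_hom] entry_closed)
    also have "\<dots> = (\<Oplus>\<^bsub>N j\<^esub> i\<in>{j - s..p'}. U i j (a i)) \<oplus>\<^bsub>N j\<^esub> (\<Oplus>\<^bsub>N j\<^esub> i\<in>{j - s..p'}. U i j (b i))"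
      using family_filtD(1)[OF a'] family_filtD(1)[OF b]
      by (intro N.M.finsum_addf) (auto simp: entry_closed)
    also have "(\<Oplus>\<^bsub>N j\<^esub> i\<in>{j - s..p'}. U i j (a i)) = matrix_map s M N U a j"
      by (rule matrix_map_eq[OF a', symmetric]) auto
    also have "(\<Oplus>\<^bsub>N j\<^esub> i\<in>{j - s..p'}. U i j (b i)) = matrix_map s M N U b j"
      by (rule matrix_map_eq[OF b, symmetric]) auto
    also have "matrix_map s M N U a j \<oplus>\<^bsub>N j\<^esub> matrix_map s M N U b j
        = (matrix_map s M N U a \<oplus>\<^bsub>family_tot N\<^esub> matrix_map s M N U b) j"
      by (rule family_tot_simps(1)[symmetric])
    finally show "matrix_map s M N U (a \<oplus>\<^bsub>family_tot M\<^esub> b) j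
        = (matrix_map s M N U a \<oplus>\<^bsub>family_tot N\<^esub> matrix_map s M N U b) j" .
  qed
qed

end

lemma matrix_comp_closed:
  assumes "matrix R s M N U" "matrix R t N P V" "x \<in> carrier (M i)"
  shows "matrix_comp t s P V U i j x \<in> carrier (P j)"
proof -
  interpret U: matrix R s M N U by fact
  interpret V: matrix R t N P V by fact
  interpret P: module R "P j" by (rule V.target_module)
  show ?thesis
    unfolding matrix_comp_def using assms(3)
    by (intro P.M.finsum_closed) (auto intro: U.entry_closed V.entry_closed)
qed

text \<open>Additivity of the entries of \<open>V\<close> and an interchange of two finite sums
  produce the matrix product. \<open>S\<close> stays free so that products with different shifts can
  be added termwise.\<close>

lemma matrix_map_matrix_map:
  assumes "matrix R s M N U" "matrix R t N P V"
    and a: "a \<in> family_filt M p" and S: "finite S" "{j - t - s..p} \<subseteq> S"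
  shows "matrix_map t N P V (matrix_map s M N U a) j = (\<Oplus>\<^bsub>P j\<^esub> i\<in>S. matrix_comp t s P V U i j (a i))"
proof -
  interpret U: matrix R s M N U by fact
  interpret V: matrix R t N P V by fact
  interpret N: module R "N i" for i by (rule U.target_module)
  interpret P: module R "P j" by (rule V.target_module)
  let ?T = "{j - t..p + s}"
  have ac: "a i \<in> carrier (M i)" for i by (rule family_filtD(1)[OF a])
  have c: "V k j (U i k (a i)) \<in> carrier (P j)" for i k by (intro V.entry_closed U.entry_closed ac)
  have "matrix_map t N P V (matrix_map s M N U a) j = (\<Oplus>\<^bsub>P j\<^esub> k\<in>?T. V k j (matrix_map s M N U a k))"
    by (rule V.matrix_map_eq[OF U.matrix_map_filt[OF a]]) auto
  also have "\<dots> = (\<Oplus>\<^bsub>P j\<^esub> k\<in>?T. \<Oplus>\<^bsub>P j\<^esub> i\<in>S. V k j (U i k (a i)))"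
  proof (rule P.M.finsum_cong'[OF refl])
    fix k assume "k \<in> ?T"
    then have "{k - s..p} \<subseteq> {j - t - s..p}" by simp
    then have "{k - s..p} \<subseteq> S" using S(2) by blast
    then have "matrix_map s M N U a k = (\<Oplus>\<^bsub>N k\<^esub> i\<in>S. U i k (a i))"
      by (rule U.matrix_map_eq[OF a S(1)])
    then show "V k j (matrix_map s M N U a k) = (\<Oplus>\<^bsub>P j\<^esub> i\<in>S. V k j (U i k (a i)))"
      using module_hom_finsum[OF U.target_module V.target_module V.entry_hom S(1),
          of "\<lambda>i. U i k (a i)" k j] U.entry_closed[OF ac] by simp
  qed (auto intro!: P.M.finsum_closed c)
  also have "\<dots> = (\<Oplus>\<^bsub>P j\<^esub> i\<in>S. \<Oplus>\<^bsub>P j\<^esub> k\<in>?T. V k j (U i k (a i)))"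
    by (rule P.M.finsum_swap) (auto intro: S c)
  also have "\<dots> = (\<Oplus>\<^bsub>P j\<^esub> i\<in>S. matrix_comp t s P V U i j (a i))"
  proof (rule P.M.finsum_cong'[OF refl])
    fix i
    show "(\<Oplus>\<^bsub>P j\<^esub> k\<in>?T. V k j (U i k (a i))) = matrix_comp t s P V U i j (a i)"
    \<comment> \<open>After the interchange \<open>k\<close> runs up to p + s, whereas the product
      stops at i + s. For i \<le> p the surplus entries of \<open>U\<close> vanish; for i > p the
      component \<open>a i\<close> is zero and both sums are zero.\<close>
    proof (cases "i \<le> p")
      case True
      show ?thesis
        unfolding matrix_comp_def
      proof (rule P.M.add.finprod_mono_neutral_cong_right[folded finsum_def])
        fix k assume "k \<in> ?T - {j - t..i + s}"
        then have "U i k (a i) = \<zero>\<^bsub>N k\<^esub>" by (intro U.entry_above ac) auto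
        then show "V k j (U i k (a i)) = \<zero>\<^bsub>P j\<^esub>" by (simp add: V.entry_zero)
      qed (use True c in auto)
    next
      case False
      then have "V k j (U i k (a i)) = \<zero>\<^bsub>P j\<^esub>" for k
        by (simp add: family_filtD(2)[OF a] U.entry_zero V.entry_zero)
      then show ?thesis by (simp add: matrix_comp_def)
    qed
  qed (auto intro: matrix_comp_closed[OF assms(1,2) ac])
  finally show ?thesis .
qed

section \<open>The total complex\<close>

text \<open>Total maps are known to equal matrix maps on carriers, and membership in
  \<open>module_hom\<close> is transported along such an equality.\<close>

lemma module_hom_cong:
  assumes "f \<in> module_hom R M N" "\<And>x. x \<in> carrier M \<Longrightarrow> g x = f x" "module R M"
  shows "g \<in> module_hom R M N"
proof -
  interpret module R M by fact
  show ?thesis using module_homD[OF assms(1)] assms(2) by (intro module_homI) auto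
qed

text \<open>The component \<open>u m\<close> lowers the column by \<open>m - s\<close>, so it contributes the entries with
  \<open>i + s - j = m\<close>, with the sign \<open>(-1)\<^sup>m\<^sup>n\<close> of the total complex and a global sign \<open>(-1)\<^sup>c\<close>.\<close>

definition sgn_matrix ::
  "(int \<Rightarrow> ('a, 'c) module) \<Rightarrow> int \<Rightarrow> int \<Rightarrow> int \<Rightarrow> (nat \<Rightarrow> int \<Rightarrow> int \<Rightarrow> 'b \<Rightarrow> 'c) \<Rightarrow>
    int \<Rightarrow> int \<Rightarrow> 'b \<Rightarrow> 'c" where
  "sgn_matrix N s n c u i j x =
     (if j \<le> i + s then msign (N j) ((i + s - j) * n + c) (u (nat (i + s - j)) i (n + i) x)
      else \<zero>\<^bsub>N j\<^esub>)"

lemma matrix_sgn_matrix: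
  assumes M: "\<And>i. module R (M i)" and N: "\<And>j. module R (N j)"
    and u: "\<And>m i. u m i (n + i) \<in> module_hom R (M i) (N (i + s - int m))"
  shows "matrix R s M N (sgn_matrix N s n c u)"
proof (rule matrix.intro[OF M N])
  have "sgn_matrix N s n c u i j \<in> module_hom R (M i) (N j)" for i j
  proof (cases "j \<le> i + s")
    case True
    then have "u (nat (i + s - j)) i (n + i) \<in> module_hom R (M i) (N j)"
      using u[of "nat (i + s - j)" i] by simp
    from module_hom_compose[OF this msign_hom[OF N]] True show ?thesis
      by (simp add: sgn_matrix_def[abs_def])
  next
    case False
    then show ?thesis using zero_module_hom[OF M N] by (simp add: sgn_matrix_def[abs_def])
  qed
  then show "filtered_matrix R s M N (sgn_matrix N s n c u)"
    by (simp add: filtered_matrix_def sgn_matrix_def)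
qed

text \<open>The parities add up as (m - l)*n + l*n' = m*n + l*(n' - n). The first part is common to
  all summands and leaves the sum together with \<open>c\<close> and \<open>c'\<close>; the second
  makes the convolution alternate exactly when n' - n is odd.\<close>

lemma matrix_comp_sgn_matrix:
  assumes M: "\<And>i. module R (M i)" and N: "\<And>j. module R (N j)" and P: "\<And>j. module R (P j)"
    and u: "\<And>m i. u m i (n + i) \<in> module_hom R (M i) (N (i + s - int m))"
    and v: "\<And>m i. v m i (n' + i) \<in> module_hom R (N i) (P (i + t - int m))"
    and x: "x \<in> carrier (M i)" and j: "j = i + s + t - int m"
  shows "matrix_comp t s P (sgn_matrix P t n' c' v) (sgn_matrix N s n c u) i j x =
    msign (P j) (int m * n + c + c') (\<Oplus>\<^bsub>P j\<^esub> l\<in>{..m}. msign (P j) (int l * (n' - n))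
      (v l (i + s - int (m - l)) (n' + (i + s - int (m - l))) (u (m - l) i (n + i) x)))"
proof -
  interpret Pj: module R "P j" by (rule P)
  define V where "V = sgn_matrix P t n' c' v"
  define U where "U = sgn_matrix N s n c u"
  define w where "w l = v l (i + s - int (m - l)) (n' + (i + s - int (m - l))) (u (m - l) i (n + i) x)" for l
  have uc: "u l i (n + i) x \<in> carrier (N (i + s - int l))" for l
    by (rule module_homD(1)[OF u x])
  have wc: "w l \<in> carrier (P j)" if "l \<le> m" for l
    using module_homD(1)[OF v uc[of "m - l"], of l] that
    by (simp add: w_def j algebra_simps of_nat_diff)
  have entry: "V k j (U i k x) = msign (P j) (int m * n + c + c') (msign (P j) (int l * (n' - n)) (w l))"
    if l: "l \<le> m" and k: "k = j - t + int l" for k l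
  proof -
    have k': "k = i + s - int (m - l)" using l k j by (simp add: of_nat_diff)
    have vk: "v l k (n' + k) \<in> module_hom R (N k) (P j)" using v[of l k] k by simp
    have uk: "u (m - l) i (n + i) x \<in> carrier (N k)" using uc[of "m - l"] k' by simp
    have "U i k x = msign (N k) (int (m - l) * n + c) (u (m - l) i (n + i) x)"
      by (simp add: U_def sgn_matrix_def k')
    moreover have "V k j y = msign (P j) (int l * n' + c') (v l k (n' + k) y)" for y
      by (simp add: V_def sgn_matrix_def k)
    ultimately have "V k j (U i k x) = msign (P j) (int l * n' + c')
        (msign (P j) (int (m - l) * n + c) (w l))"
      using module_hom_msign[OF N P vk uk] by (simp add: w_def k')
    also have "\<dots> = msign (P j) (int m * n + c + c' + int l * (n' - n)) (w l)"
      unfolding msign_msign[OF P wc[OF l]]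
      by (rule msign_parity) (simp add: of_nat_diff[OF l] algebra_simps)
    finally show ?thesis by (simp add: msign_msign[OF P wc[OF l]])
  qed
  \<comment> \<open>Since i + s - (j - t) = m, the intermediate columns are j - t + l for l = 0,
    ..., m, where l is the index of the second factor.\<close>
  have "{j - t..i + s} = (\<lambda>l. j - t + int l) ` {..m}"
  proof -
    have "k \<in> (\<lambda>l. j - t + int l) ` {..m}" if "k \<in> {j - t..i + s}" for k
      using that j by (intro image_eqI[of _ _ "nat (k - (j - t))"]) auto
    then show ?thesis using j by auto
  qed
  then have "matrix_comp t s P V U i j x = (\<Oplus>\<^bsub>P j\<^esub> k\<in>(\<lambda>l. j - t + int l) ` {..m}. V k j (U i k x))"
    by (simp add: matrix_comp_def)
  also have "\<dots> = (\<Oplus>\<^bsub>P j\<^esub> l\<in>{..m}. V (j - t + int l) j (U i (j - t + int l) x))"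
    by (rule Pj.M.finsum_reindex) (auto simp: inj_on_def entry wc intro!: msign_closed[OF P])
  also have "\<dots> = (\<Oplus>\<^bsub>P j\<^esub> l\<in>{..m}. msign (P j) (int m * n + c + c') (msign (P j) (int l * (n' - n)) (w l)))"
    by (rule Pj.M.finsum_cong') (auto simp: entry wc intro!: msign_closed[OF P])
  also have "\<dots> = msign (P j) (int m * n + c + c') (\<Oplus>\<^bsub>P j\<^esub> l\<in>{..m}. msign (P j) (int l * (n' - n)) (w l))"
    by (rule module_hom_finsum[OF P P msign_hom[OF P], symmetric])
      (auto intro!: msign_closed[OF P] wc)
  finally show ?thesis unfolding V_def U_def w_def .
qed

lemma matrix_comp_above:
  assumes "module R (P j)" "i + s + t < j"
  shows "matrix_comp t s P V U i j x = \<zero>\<^bsub>P j\<^esub>"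
proof -
  interpret Pj: module R "P j" by fact
  have "{j - t..i + s} = {}" using assms(2) by auto
  then show ?thesis by (simp only: matrix_comp_def Pj.M.finsum_empty)
qed

lemma matrix_map_sgn_matrix_zero:
  assumes M: "\<And>i. module R (M i)" and N: "\<And>j. module R (N j)"
    and u: "\<And>m i. u m i (n + i) \<in> module_hom R (M i) (N (i - int m))"
    and a: "a \<in> carrier (family_tot M)"
  shows "matrix_map 0 M N (sgn_matrix N 0 n 0 u) a j =
    (\<Oplus>\<^bsub>N j\<^esub> m\<in>{m. a (j + int m) \<noteq> \<zero>\<^bsub>M (j + int m)\<^esub>}.
      msign (N j) (int m * n) (u m (j + int m) (n + (j + int m)) (a (j + int m))))"
proof -
  interpret Nj: module R "N j" by (rule N)
  let ?U = "sgn_matrix N 0 n 0 u"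
  interpret U: matrix R 0 M N ?U by (rule matrix_sgn_matrix) (use M N u in simp_all)
  let ?S = "{m. a (j + int m) \<noteq> \<zero>\<^bsub>M (j + int m)\<^esub>}"
  have ac: "a i \<in> carrier (M i)" for i using a by (simp add: family_tot_def)
  have eq: "?U (j + int m) j y = msign (N j) (int m * n) (u m (j + int m) (n + (j + int m)) y)" for m y
    by (simp add: sgn_matrix_def)
  have "i \<in> (\<lambda>m. j + int m) ` ?S" if "j \<le> i" "a i \<noteq> \<zero>\<^bsub>M i\<^esub>" for i
    using that by (intro image_eqI[of _ _ "nat (i - j)"]) auto
  then have "{i. j \<le> i + 0 \<and> a i \<noteq> \<zero>\<^bsub>M i\<^esub>} = (\<lambda>m. j + int m) ` ?S" by auto
  then have "matrix_map 0 M N ?U a j = (\<Oplus>\<^bsub>N j\<^esub> i\<in>(\<lambda>m. j + int m) ` ?S. ?U i j (a i))"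
    by (simp only: matrix_map_def)
  also have "\<dots> = (\<Oplus>\<^bsub>N j\<^esub> m\<in>?S. ?U (j + int m) j (a (j + int m)))"
    by (rule Nj.M.finsum_reindex) (auto simp: inj_on_def intro!: U.entry_closed ac)
  finally show ?thesis by (simp only: eq)
qed

section \<open>Twisted complexes and their morphisms as matrices\<close>

abbreviation column :: "('a, 'b) twisted \<Rightarrow> int \<Rightarrow> int \<Rightarrow> ('a, 'b) module" where
  "column A n i \<equiv> cmp A i (n + i)"

lemma tot_mod_eq: "tot_mod A n = family_tot (column A n)"
  by (simp add: tot_mod_def family_tot_def)

lemma tot_filt_eq: "tot_filt A p n = family_filt (column A n) p"
  using family_filt_subset[of "column A n" p]
  by (auto simp: tot_filt_def tot_mod_eq family_filt_def) (auto simp: family_tot_def)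

lemma twisted_complexD:
  assumes "twisted_complex R A"
  shows "module R (cmp A i j)"
    and "tdiff A m i j \<in> module_hom R (cmp A i j) (cmp A (i - int m) (j - int m + 1))"
    and "x \<in> carrier (cmp A i j) \<Longrightarrow>
      (\<Oplus>\<^bsub>cmp A (i - int m) (j - int m + 2)\<^esub> k\<in>{..m}. msign (cmp A (i - int m) (j - int m + 2)) (int k)
        (tdiff A k (i - int (m - k)) (j - int (m - k) + 1) (tdiff A (m - k) i j x)))
      = \<zero>\<^bsub>cmp A (i - int m) (j - int m + 2)\<^esub>"
  using assms by (auto simp: twisted_complex_def Let_def)

lemma tmorphismD:
  assumes "tmorphism R A B f"
  shows "f m i j \<in> module_hom R (cmp A i j) (cmp B (i - int m) (j - int m))"
    and "x \<in> carrier (cmp A i j) \<Longrightarrow>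
      (\<Oplus>\<^bsub>cmp B (i - int m) (j - int m + 1)\<^esub> k\<in>{..m}.
        tdiff B k (i - int (m - k)) (j - int (m - k)) (f (m - k) i j x)) =
      (\<Oplus>\<^bsub>cmp B (i - int m) (j - int m + 1)\<^esub> k\<in>{..m}. msign (cmp B (i - int m) (j - int m + 1)) (int k)
        (f k (i - int (m - k)) (j - int (m - k) + 1) (tdiff A (m - k) i j x)))"
  using assms by (auto simp: tmorphism_def Let_def)

definition diff_matrix :: "('a, 'b) twisted \<Rightarrow> int \<Rightarrow> int \<Rightarrow> int \<Rightarrow> 'b \<Rightarrow> 'b" where
  "diff_matrix A n = sgn_matrix (column A (n + 1)) 0 n 0 (tdiff A)"

definition map_matrix :: "('a, 'c) twisted \<Rightarrow> ('b, 'c) tmap \<Rightarrow> int \<Rightarrow> int \<Rightarrow> int \<Rightarrow> 'b \<Rightarrow> 'c" where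
  "map_matrix B f n = sgn_matrix (column B n) 0 n 0 f"

lemma tdiff_column_hom:
  assumes "twisted_complex R A"
  shows "tdiff A m i (n + i) \<in> module_hom R (column A n i) (column A (n + 1) (i + 0 - int m))"
  using twisted_complexD(2)[OF assms, of m i "n + i"] by (simp add: algebra_simps)

lemma tmap_column_hom:
  assumes "tmorphism R A B f"
  shows "f m i (n + i) \<in> module_hom R (column A n i) (column B n (i + 0 - int m))"
  using tmorphismD(1)[OF assms, of m i "n + i"] by (simp add: algebra_simps)

lemma matrix_diff_matrix:
  assumes "twisted_complex R A"
  shows "matrix R 0 (column A n) (column A (n + 1)) (diff_matrix A n)"
  unfolding diff_matrix_def
  by (rule matrix_sgn_matrix; rule twisted_complexD(1)[OF assms] tdiff_column_hom[OF assms])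

lemma matrix_map_matrix:
  assumes "twisted_complex R A" "twisted_complex R B" "tmorphism R A B f"
  shows "matrix R 0 (column A n) (column B n) (map_matrix B f n)"
  unfolding map_matrix_def
  by (rule matrix_sgn_matrix; rule twisted_complexD(1)[OF assms(1)] twisted_complexD(1)[OF assms(2)]
      tmap_column_hom[OF assms(3)])

lemma tot_diff_eq:
  assumes "twisted_complex R A" "a \<in> carrier (tot_mod A n)"
  shows "tot_diff A n a = matrix_map 0 (column A n) (column A (n + 1)) (diff_matrix A n) a"
  using matrix_map_sgn_matrix_zero[of R "column A n" "column A (n + 1)" "tdiff A" n a,
      OF twisted_complexD(1)[OF assms(1)] twisted_complexD(1)[OF assms(1)]]
    tdiff_column_hom[OF assms(1), of _ _ n] assms(2)
  by (simp add: tot_diff_def diff_matrix_def tot_mod_eq fun_eq_iff)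

lemma tot_map_eq:
  assumes "twisted_complex R A" "twisted_complex R B" "tmorphism R A B f" "a \<in> carrier (tot_mod A n)"
  shows "tot_map A B f n a = matrix_map 0 (column A n) (column B n) (map_matrix B f n) a"
  using matrix_map_sgn_matrix_zero[of R "column A n" "column B n" f n a,
      OF twisted_complexD(1)[OF assms(1)] twisted_complexD(1)[OF assms(2)]]
    tmap_column_hom[OF assms(3), of _ _ n] assms(4)
  by (simp add: tot_map_def map_matrix_def tot_mod_eq fun_eq_iff)

text \<open>The two differentials act in degrees n and n + 1, so the product formula creates the
  sign (-1)^l of the axiom for twisted complexes. Above the diagonal the product is zero by its
  shape.\<close>

lemma diff_matrix_diff_matrix:
  assumes A: "twisted_complex R A" and x: "x \<in> carrier (column A n i)"
  shows "matrix_comp 0 0 (column A (n + 1 + 1)) (diff_matrix A (n + 1)) (diff_matrix A n) i j x =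
    \<zero>\<^bsub>column A (n + 1 + 1) j\<^esub>"
proof (cases "j \<le> i")
  case True
  then obtain m where m: "j = i + 0 + 0 - int m" using zle_iff_zadd[of j i] by auto
  note mod = twisted_complexD(1)[OF A]
  have eq1: "n + i - int m + 2 = n + 1 + 1 + j" using m by simp
  have eq2: "n + i - int (m - k) + 1 = n + 1 + (i + 0 - int (m - k))" for k by simp
  have "(\<Oplus>\<^bsub>column A (n + 1 + 1) j\<^esub> k\<in>{..m}. msign (column A (n + 1 + 1) j) (int k * (n + 1 - n))
        (tdiff A k (i + 0 - int (m - k)) (n + 1 + (i + 0 - int (m - k))) (tdiff A (m - k) i (n + i) x)))
      = \<zero>\<^bsub>column A (n + 1 + 1) j\<^esub>"
    using twisted_complexD(3)[OF A x, of m, unfolded eq1 eq2] m by simp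
  then show ?thesis
    unfolding diff_matrix_def
      matrix_comp_sgn_matrix[where M = "column A n" and N = "column A (n + 1)" and P = "column A (n + 1 + 1)"
        and u = "tdiff A" and v = "tdiff A" and n = "n" and n' = "n + 1" and s = 0 and t = 0 and c = 0 and c' = 0,
        OF mod mod mod tdiff_column_hom[OF A] tdiff_column_hom[OF A] x m]
    using module_hom_zero[OF mod mod msign_hom[OF mod]] by simp
next
  case False
  then show ?thesis
    by (intro matrix_comp_above[of R] twisted_complexD(1)[OF A]) simp
qed

text \<open>In d f both factors act in degree n and no inner sign appears; in f d the degrees differ
  by 1 and the sign (-1)^l appears. Both products have the same global sign (-1)^(m*n), so the
  morphism axiom remains.\<close>

lemma diff_matrix_map_matrix:
  assumes A: "twisted_complex R A" and B: "twisted_complex R B" and f: "tmorphism R A B f"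
    and x: "x \<in> carrier (column A n i)"
  shows "matrix_comp 0 0 (column B (n + 1)) (diff_matrix B n) (map_matrix B f n) i j x =
    matrix_comp 0 0 (column B (n + 1)) (map_matrix B f (n + 1)) (diff_matrix A n) i j x"
proof (cases "j \<le> i")
  case True
  then obtain m where m: "j = i + 0 + 0 - int m" using zle_iff_zadd[of j i] by auto
  note modA = twisted_complexD(1)[OF A] and modB = twisted_complexD(1)[OF B]
  have eq1: "n + i - int m + 1 = n + 1 + j" using m by simp
  have eq2: "n + i - int (m - k) + 1 = n + 1 + (i - int (m - k))"
    and eq3: "n + i - int (m - k) = n + (i - int (m - k))" for k by simp_all
  show ?thesis
    unfolding diff_matrix_def map_matrix_def
      matrix_comp_sgn_matrix[where M = "column A n" and N = "column B n" and P = "column B (n + 1)"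
        and u = "f" and v = "tdiff B" and n = "n" and n' = "n" and s = 0 and t = 0 and c = 0 and c' = 0,
        OF modA modB modB tmap_column_hom[OF f] tdiff_column_hom[OF B] x m]
      matrix_comp_sgn_matrix[where M = "column A n" and N = "column A (n + 1)" and P = "column B (n + 1)"
        and u = "tdiff A" and v = "f" and n = "n" and n' = "n + 1" and s = 0 and t = 0 and c = 0 and c' = 0,
        OF modA modA modB tdiff_column_hom[OF A] tmap_column_hom[OF f] x m]
    using tmorphismD(2)[OF f x, of m, unfolded eq1 eq2, unfolded eq3] m by (simp add: msign_def)
next
  case False
  then have "i + 0 + 0 < j" by simp
  note above = matrix_comp_above[where P = "column B (n + 1)" and j = j, OF twisted_complexD(1)[OF B] this]
  show ?thesis by (simp only: above)
qed

text \<open>Both factors act in degree n, so the convolution has no inner sign and is that of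
  \<open>tcomp\<close>. The remaining sign is the one that the total map of the composite would
  carry at index \<open>m\<close>.\<close>

lemma map_matrix_map_matrix:
  assumes A: "twisted_complex R A" and B: "twisted_complex R B" and C: "twisted_complex R C"
    and f: "tmorphism R A B f" and g: "tmorphism R B C g"
    and x: "x \<in> carrier (column A n i)" and m: "j = i - int m"
  shows "matrix_comp 0 0 (column C n) (map_matrix C g n) (map_matrix B f n) i j x =
    msign (column C n j) (int m * n) (tcomp C g f m i (n + i) x)"
proof -
  have m': "j = i + 0 + 0 - int m" using m by simp
  note modA = twisted_complexD(1)[OF A] and modB = twisted_complexD(1)[OF B]
    and modC = twisted_complexD(1)[OF C]
  have eq: "n + i - int k = n + (i - int k)" for k by simp
  show ?thesis
    unfolding map_matrix_def tcomp_def eq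
      matrix_comp_sgn_matrix[where M = "column A n" and N = "column B n" and P = "column C n"
        and u = "f" and v = "g" and n = "n" and n' = "n" and s = 0 and t = 0 and c = 0 and c' = 0,
        OF modA modB modC tmap_column_hom[OF f] tmap_column_hom[OF g] x m']
    using m by (simp add: msign_def)
qed

section \<open>Total complexes as filtered complexes, total maps as filtered chain maps\<close>

lemma filtered_module_complex_Tot:
  assumes A: "twisted_complex R A"
  shows "filtered_module_complex R (Tot A)"
proof (rule filtered_module_complex.intro)
  note mod = twisted_complexD(1)[OF A]
  fix n p p'
  show tot: "module R (fc_mod (Tot A) n)"
    by (simp add: Tot_def tot_mod_eq module_family_tot mod)
  show "submodule (fc_filt (Tot A) p n) R (fc_mod (Tot A) n)"
    by (simp add: Tot_def tot_mod_eq tot_filt_eq submodule_family_filt mod)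
  show "fc_filt (Tot A) p n \<subseteq> fc_filt (Tot A) p' n" if "p \<le> p'"
    using that by (simp add: Tot_def tot_filt_eq family_filt_mono)
  interpret D: matrix R 0 "column A n" "column A (n + 1)" "diff_matrix A n"
    by (rule matrix_diff_matrix[OF A])
  have d: "fc_diff (Tot A) n a = matrix_map 0 (column A n) (column A (n + 1)) (diff_matrix A n) a"
    if "a \<in> carrier (fc_mod (Tot A) n)" for a
    using tot_diff_eq[OF A] that by (simp add: Tot_def)
  show hom: "fc_diff (Tot A) n \<in> module_hom R (fc_mod (Tot A) n) (fc_mod (Tot A) (n + 1))"
    using D.matrix_map_hom
    by (intro module_hom_cong[OF _ d tot]) (simp_all add: Tot_def tot_mod_eq)
  show "fc_diff (Tot A) n a \<in> fc_filt (Tot A) p (n + 1)" if a: "a \<in> fc_filt (Tot A) p n" for a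
  proof -
    have a': "a \<in> family_filt (column A n) p" using a by (simp add: Tot_def tot_filt_eq)
    then have "a \<in> carrier (fc_mod (Tot A) n)"
      using family_filt_subset by (auto simp: Tot_def tot_mod_eq)
    from d[OF this] show ?thesis
      using D.matrix_map_filt[OF a'] by (simp add: Tot_def tot_filt_eq)
  qed
  show "fc_diff (Tot A) (n + 1) (fc_diff (Tot A) n a) = \<zero>\<^bsub>fc_mod (Tot A) (n + 1 + 1)\<^esub>"
    if a: "a \<in> carrier (fc_mod (Tot A) n)" for a
  proof
    fix j
    obtain p where p: "a \<in> family_filt (column A n) p"
      using a by (auto simp: Tot_def tot_mod_eq carrier_family_tot)
    interpret T: module R "column A (n + 1 + 1) j" by (rule mod)
    have "fc_diff (Tot A) n a \<in> carrier (tot_mod A (n + 1))"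
      using module_homD(1)[OF hom a] by (simp add: Tot_def)
    then have "fc_diff (Tot A) (n + 1) (fc_diff (Tot A) n a) j =
        matrix_map 0 (column A (n + 1)) (column A (n + 1 + 1)) (diff_matrix A (n + 1))
          (matrix_map 0 (column A n) (column A (n + 1)) (diff_matrix A n) a) j"
      using tot_diff_eq[OF A, of _ "n + 1"] d[OF a] by (simp add: Tot_def)
    also have "\<dots> = (\<Oplus>\<^bsub>column A (n + 1 + 1) j\<^esub> i\<in>{j..p}.
        matrix_comp 0 0 (column A (n + 1 + 1)) (diff_matrix A (n + 1)) (diff_matrix A n) i j (a i))"
      by (rule matrix_map_matrix_map[OF matrix_diff_matrix[OF A] matrix_diff_matrix[OF A] p]) auto
    also have "\<dots> = \<zero>\<^bsub>column A (n + 1 + 1) j\<^esub>"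
      by (simp only: diff_matrix_diff_matrix[OF A family_filtD(1)[OF p]] T.M.finsum_zero)
    also have "\<dots> = \<zero>\<^bsub>fc_mod (Tot A) (n + 1 + 1)\<^esub> j"
      by (simp add: Tot_def tot_mod_def)
    finally show "fc_diff (Tot A) (n + 1) (fc_diff (Tot A) n a) j = \<zero>\<^bsub>fc_mod (Tot A) (n + 1 + 1)\<^esub> j" .
  qed
qed

lemma filtered_map_Tot:
  assumes A: "twisted_complex R A" and B: "twisted_complex R B" and f: "tmorphism R A B f"
  shows "filtered_map R (Tot A) (Tot B) (tot_map A B f)"
proof (intro filtered_map.intro filtered_map_axioms.intro)
  show TA: "filtered_module_complex R (Tot A)" and TB: "filtered_module_complex R (Tot B)"
    by (rule filtered_module_complex_Tot; fact)+
  interpret A: filtered_module_complex R "Tot A" by (rule TA)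
  note modA = twisted_complexD(1)[OF A] and modB = twisted_complexD(1)[OF B]
  fix n
  interpret F: matrix R 0 "column A n" "column B n" "map_matrix B f n"
    by (rule matrix_map_matrix[OF A B f])
  have F: "tot_map A B f n a = matrix_map 0 (column A n) (column B n) (map_matrix B f n) a"
    if "a \<in> carrier (fc_mod (Tot A) n)" for a
    using tot_map_eq[OF A B f] that by (simp add: Tot_def)
  show hom: "tot_map A B f n \<in> module_hom R (fc_mod (Tot A) n) (fc_mod (Tot B) n)"
    using F.matrix_map_hom
    by (intro module_hom_cong[OF _ F A.fc_module]) (simp_all add: Tot_def tot_mod_eq)
  show "tot_map A B f n a \<in> fc_filt (Tot B) p n" if a: "a \<in> fc_filt (Tot A) p n" for a p
    using F.matrix_map_filt[of a p] a F[OF A.fc_filt_carrier[OF a]]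
    by (simp add: Tot_def tot_filt_eq)
  show "tot_map A B f (n + 1) (fc_diff (Tot A) n a) = fc_diff (Tot B) n (tot_map A B f n a)"
    if a: "a \<in> carrier (fc_mod (Tot A) n)" for a
  proof
    fix j
    obtain p where p: "a \<in> family_filt (column A n) p"
      using a by (auto simp: Tot_def tot_mod_eq carrier_family_tot)
    interpret T: module R "column B (n + 1) j" by (rule modB)
    note DA = matrix_diff_matrix[OF A, of n] and DB = matrix_diff_matrix[OF B, of n]
      and Fn = matrix_map_matrix[OF A B f]
    have da: "fc_diff (Tot A) n a \<in> carrier (tot_mod A (n + 1))"
      using A.fc_diff_closed[OF a] by (simp add: Tot_def)
    have fa: "tot_map A B f n a \<in> carrier (tot_mod B n)"
      using module_homD(1)[OF hom a] by (simp add: Tot_def)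
    have "tot_map A B f (n + 1) (fc_diff (Tot A) n a) j =
        matrix_map 0 (column A (n + 1)) (column B (n + 1)) (map_matrix B f (n + 1))
          (matrix_map 0 (column A n) (column A (n + 1)) (diff_matrix A n) a) j"
      using tot_map_eq[OF A B f da] tot_diff_eq[OF A, of a n] a by (simp add: Tot_def)
    also have "\<dots> = (\<Oplus>\<^bsub>column B (n + 1) j\<^esub> i\<in>{j..p}.
        matrix_comp 0 0 (column B (n + 1)) (map_matrix B f (n + 1)) (diff_matrix A n) i j (a i))"
      by (rule matrix_map_matrix_map[OF DA Fn p]) auto
    also have "\<dots> = (\<Oplus>\<^bsub>column B (n + 1) j\<^esub> i\<in>{j..p}.
        matrix_comp 0 0 (column B (n + 1)) (diff_matrix B n) (map_matrix B f n) i j (a i))"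
      by (simp only: diff_matrix_map_matrix[OF A B f family_filtD(1)[OF p]])
    also have "\<dots> = matrix_map 0 (column B n) (column B (n + 1)) (diff_matrix B n)
          (matrix_map 0 (column A n) (column B n) (map_matrix B f n) a) j"
      by (rule matrix_map_matrix_map[OF Fn DB p, symmetric]) auto
    also have "\<dots> = fc_diff (Tot B) n (tot_map A B f n a) j"
      using tot_diff_eq[OF B fa] F[OF a] by (simp add: Tot_def)
    finally show "tot_map A B f (n + 1) (fc_diff (Tot A) n a) j = fc_diff (Tot B) n (tot_map A B f n a) j" .
  qed
qed

section \<open>Homotopies\<close>

lemma direct_sum3_simps:
  "carrier (direct_sum3 L M N) = carrier L \<times> carrier M \<times> carrier N"
  "\<zero>\<^bsub>direct_sum3 L M N\<^esub> = (\<zero>\<^bsub>L\<^esub>, \<zero>\<^bsub>M\<^esub>, \<zero>\<^bsub>N\<^esub>)"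
  "(x, y, z) \<oplus>\<^bsub>direct_sum3 L M N\<^esub> (x', y', z') = (x \<oplus>\<^bsub>L\<^esub> x', y \<oplus>\<^bsub>M\<^esub> y', z \<oplus>\<^bsub>N\<^esub> z')"
  "c \<odot>\<^bsub>direct_sum3 L M N\<^esub> (x, y, z) = (c \<odot>\<^bsub>L\<^esub> x, c \<odot>\<^bsub>M\<^esub> y, c \<odot>\<^bsub>N\<^esub> z)"
  by (simp_all add: direct_sum3_def)

lemma module_direct_sum3:
  assumes "module R L" "module R M" "module R N"
  shows "module R (direct_sum3 L M N)"
proof -
  interpret L: module R L by fact
  interpret M: module R M by fact
  interpret N: module R N by fact
  have "abelian_group (direct_sum3 L M N)"
  proof (rule abelian_groupI)
    fix p assume "p \<in> carrier (direct_sum3 L M N)"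
    then obtain x y z where p: "p = (x, y, z)" "x \<in> carrier L" "y \<in> carrier M" "z \<in> carrier N"
      by (auto simp: direct_sum3_simps)
    show "\<exists>q\<in>carrier (direct_sum3 L M N). q \<oplus>\<^bsub>direct_sum3 L M N\<^esub> p = \<zero>\<^bsub>direct_sum3 L M N\<^esub>"
      using p by (intro bexI[of _ "(\<ominus>\<^bsub>L\<^esub> x, \<ominus>\<^bsub>M\<^esub> y, \<ominus>\<^bsub>N\<^esub> z)"])
        (auto simp: direct_sum3_simps L.M.l_neg M.M.l_neg N.M.l_neg)
  qed (auto simp: direct_sum3_simps L.M.a_ac M.M.a_ac N.M.a_ac)
  then show ?thesis
    by (intro moduleI L.R.cring_axioms)
      (auto simp: direct_sum3_simps L.smult_l_distr M.smult_l_distr N.smult_l_distr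
        L.smult_r_distr M.smult_r_distr N.smult_r_distr L.smult_assoc1 M.smult_assoc1 N.smult_assoc1)
qed

lemma direct_sum3_middle_hom: "(\<lambda>p. fst (snd p)) \<in> module_hom R (direct_sum3 L M N) M"
  by (auto simp: module_hom_def direct_sum3_simps)

lemma cmp_path:
  "cmp (path r B) i j = direct_sum3 (cmp B i j) (cmp B (i + int r) (j + int r - 1)) (cmp B i j)"
  by (simp add: path_def)

text \<open>A strict map is zero at positive indices, so only the summand k = 0 of the convolution
  survives.\<close>

lemma tcomp_strict_tmap:
  assumes B: "module R (cmp B (i - int m) (j - int m))"
    and y: "\<phi> (i - int m) (j - int m) (h m i j x) \<in> carrier (cmp B (i - int m) (j - int m))"
  shows "tcomp B (strict_tmap B \<phi>) h m i j x = \<phi> (i - int m) (j - int m) (h m i j x)"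
proof -
  interpret T: module R "cmp B (i - int m) (j - int m)" by fact
  have "tcomp B (strict_tmap B \<phi>) h m i j x =
    (\<Oplus>\<^bsub>cmp B (i - int m) (j - int m)\<^esub> k\<in>{..m}. if 0 = k then \<phi> (i - int m) (j - int m) (h m i j x)
      else \<zero>\<^bsub>cmp B (i - int m) (j - int m)\<^esub>)"
    unfolding tcomp_def
  proof (rule T.M.finsum_cong'[OF refl])
    fix k assume "k \<in> {..m}"
    then have "i - int (m - k) - int k = i - int m" "j - int (m - k) - int k = j - int m"
      by (simp_all add: of_nat_diff)
    then show "strict_tmap B \<phi> k (i - int (m - k)) (j - int (m - k)) (h (m - k) i j x) =
        (if 0 = k then \<phi> (i - int m) (j - int m) (h m i j x) else \<zero>\<^bsub>cmp B (i - int m) (j - int m)\<^esub>)"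
      by (auto simp: strict_tmap_def)
  qed (use y in auto)
  also have "\<dots> = \<phi> (i - int m) (j - int m) (h m i j x)"
    using y by (intro T.M.finsum_singleton) auto
  finally show ?thesis .
qed

text \<open>The middle summand of the path complex sits \<open>r\<close> columns higher. So the
  component of index \<open>m\<close> lands in bidegree (i - m + r, j - m + r - 1): it raises the
  column by at most \<open>r\<close> and lowers the total degree j - i by 1.\<close>

definition homotopy_middle :: "('b, 'c \<times> 'c \<times> 'c) tmap \<Rightarrow> ('b, 'c) tmap" where
  "homotopy_middle h m i j x = fst (snd (h m i j x))"

text \<open>The projections of the path complex are strict, so composing with them reads off the
  outer entries of each component of \<open>h\<close>. The membership claims come from
  \<open>h\<close> itself, which is how a composite \<open>f\<close> is seen to land in the right
  module.\<close>

lemma homotopy_components: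
  assumes B: "twisted_complex R B" and h: "homotopy R r A B h f g"
    and x: "x \<in> carrier (cmp A i j)"
  shows "h m i j x = (f m i j x, homotopy_middle h m i j x, g m i j x)"
    and "f m i j x \<in> carrier (cmp B (i - int m) (j - int m))"
    and "g m i j x \<in> carrier (cmp B (i - int m) (j - int m))"
proof -
  have hm: "tmorphism R A (path r B) h" using h by (simp add: homotopy_def)
  have hc: "h m i j x \<in> carrier (cmp (path r B) (i - int m) (j - int m))"
    by (rule module_homD(1)[OF tmorphismD(1)[OF hm] x])
  then obtain u v w where huvw: "h m i j x = (u, v, w)"
    and uw: "u \<in> carrier (cmp B (i - int m) (j - int m))" "w \<in> carrier (cmp B (i - int m) (j - int m))"
    by (auto simp: cmp_path direct_sum3_simps)
  have "tcomp B (path_src B) h m i j x = u" "tcomp B (path_tgt B) h m i j x = w"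
    using tcomp_strict_tmap[OF twisted_complexD(1)[OF B], where h = h and x = x] huvw uw
    by (simp_all add: path_src_def path_tgt_def)
  then have fg: "f m i j x = u" "g m i j x = w"
    using h x by (auto simp: homotopy_def tmap_eq_def)
  then show "h m i j x = (f m i j x, homotopy_middle h m i j x, g m i j x)"
    using huvw by (simp add: homotopy_middle_def)
  show "f m i j x \<in> carrier (cmp B (i - int m) (j - int m))"
    "g m i j x \<in> carrier (cmp B (i - int m) (j - int m))"
    using fg uw by simp_all
qed

lemma homotopy_middle_hom:
  assumes h: "homotopy R r A B h f g"
  shows "homotopy_middle h m i j \<in>
    module_hom R (cmp A i j) (cmp B (i - int m + int r) (j - int m + int r - 1))"
proof -
  have "tmorphism R A (path r B) h" using h by (simp add: homotopy_def)
  from module_hom_compose[OF tmorphismD(1)[OF this, of m i j, unfolded cmp_path] direct_sum3_middle_hom]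
  show ?thesis by (simp add: homotopy_middle_def[abs_def])
qed

text \<open>This is the morphism equation for \<open>h\<close> projected to the middle summand of
  the path complex. The terms with the differential of \<open>B\<close> are moved across, and the
  endpoints -x + z of the special component of index \<open>r\<close> leave g - f at index m -
  r.\<close>

lemma homotopy_middle_equation:
  assumes A: "twisted_complex R A" and B: "twisted_complex R B" and h: "homotopy R r A B h f g"
    and x: "x \<in> carrier (cmp A i j)"
    and T: "T = cmp B (i + int r - int m) (j + int r - int m)"
  shows "(\<Oplus>\<^bsub>T\<^esub> k\<in>{..m}. msign T (int k + int r)
        (tdiff B k (i + int r - int (m - k)) (j + int r - int (m - k) - 1) (homotopy_middle h (m - k) i j x)))
      \<oplus>\<^bsub>T\<^esub>
      (\<Oplus>\<^bsub>T\<^esub> k\<in>{..m}. msign T (int k)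
        (homotopy_middle h k (i - int (m - k)) (j - int (m - k) + 1) (tdiff A (m - k) i j x)))
      = (if r \<le> m then g (m - r) i j x \<ominus>\<^bsub>T\<^esub> f (m - r) i j x else \<zero>\<^bsub>T\<^esub>)"
proof -
  note modA = twisted_complexD(1)[OF A] and modB = twisted_complexD(1)[OF B]
  interpret T: module R T unfolding T by (rule modB)
  have hm: "tmorphism R A (path r B) h" using h by (simp add: homotopy_def)
  define P where "P = cmp (path r B) (i - int m) (j - int m + 1)"
  have P_eq: "P = direct_sum3 (cmp B (i - int m) (j - int m + 1)) T (cmp B (i - int m) (j - int m + 1))"
    by (simp add: P_def cmp_path T algebra_simps)
  have P: "module R P" unfolding P_eq by (intro module_direct_sum3 T.module_axioms modB)
  define \<pi> :: "'c \<times> 'c \<times> 'c \<Rightarrow> 'c" where "\<pi> = (\<lambda>p. fst (snd p))"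
  have \<pi>: "\<pi> \<in> module_hom R P T" unfolding P_eq \<pi>_def by (rule direct_sum3_middle_hom)
  define dh where "dh k = tdiff B k (i + int r - int (m - k)) (j + int r - int (m - k) - 1)
    (homotopy_middle h (m - k) i j x)" for k
  define Dh where "Dh k = tdiff (path r B) k (i - int (m - k)) (j - int (m - k)) (h (m - k) i j x)" for k
  define hd where "hd k = homotopy_middle h k (i - int (m - k)) (j - int (m - k) + 1) (tdiff A (m - k) i j x)" for k
  define hD where "hD k = h k (i - int (m - k)) (j - int (m - k) + 1) (tdiff A (m - k) i j x)" for k
  define fm gm where "fm = f (m - r) i j x" and "gm = g (m - r) i j x"
  have dh: "dh k \<in> carrier T" if "k \<le> m" for k
    using module_homD(1)[OF twisted_complexD(2)[OF B]
        module_homD(1)[OF homotopy_middle_hom[OF h, of "m - k" i j] x], of k] that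
    by (simp add: dh_def T of_nat_diff algebra_simps)
  have dA: "tdiff A k i j x \<in> carrier (cmp A (i - int k) (j - int k + 1))" for k
    by (rule module_homD(1)[OF twisted_complexD(2)[OF A] x])
  have hD: "hD k \<in> carrier P" if "k \<le> m" for k
    using module_homD(1)[OF tmorphismD(1)[OF hm] dA[of "m - k"], of k] that
    by (simp add: hD_def P_def of_nat_diff algebra_simps)
  have hd: "hd k = \<pi> (hD k)" for k by (simp add: hd_def hD_def \<pi>_def homotopy_middle_def)
  have hdc: "hd k \<in> carrier T" if "k \<le> m" for k
    using module_homD(1)[OF \<pi> hD[OF that]] hd by simp
  have fgc: "fm \<in> carrier T" "gm \<in> carrier T" if "r \<le> m"
    using homotopy_components(2,3)[OF B h x, of "m - r"] that
    by (simp_all add: fm_def gm_def T of_nat_diff algebra_simps)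
  \<comment> \<open>The middle entry of the path differential contains d_k with sign (-1)^(k+r+1),
    also for k = r where that sign is -1. Adding d_k with sign (-1)^(k+r) cancels it, and only the
    endpoints at k = r remain.\<close>
  have Dhc: "Dh k \<in> carrier P \<and> \<pi> (Dh k) \<oplus>\<^bsub>T\<^esub> msign T (int k + int r) (dh k) =
      (if r = k then gm \<ominus>\<^bsub>T\<^esub> fm else \<zero>\<^bsub>T\<^esub>)" if k: "k \<le> m" for k
  proof -
    have idx: "i - int (m - k) - int k = i - int m" "j - int (m - k) - int k = j - int m"
      using k by (simp_all add: of_nat_diff)
    define u v w where "u = f (m - k) i j x" and "v = homotopy_middle h (m - k) i j x"
      and "w = g (m - k) i j x"
    have huvw: "h (m - k) i j x = (u, v, w)"
      unfolding u_def v_def w_def by (rule homotopy_components(1)[OF B h x])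
    have dv: "tdiff B k (i - int (m - k) + int r) (j - int (m - k) + int r - 1) v = dh k"
      by (simp add: dh_def v_def algebra_simps)
    have T': "cmp B (i - int (m - k) - int k + int r) (j - int (m - k) - int k + 1 + int r - 1) = T"
      unfolding idx by (simp add: T algebra_simps)
    have du: "tdiff B k (i - int (m - k)) (j - int (m - k)) y \<in> carrier (cmp B (i - int m) (j - int m + 1))"
      if "y \<in> carrier (cmp B (i - int (m - k)) (j - int (m - k)))" for y
      using module_homD(1)[OF twisted_complexD(2)[OF B, of k "i - int (m - k)" "j - int (m - k)"] that]
      unfolding idx .
    have uw: "u \<in> carrier (cmp B (i - int (m - k)) (j - int (m - k)))"
      "w \<in> carrier (cmp B (i - int (m - k)) (j - int (m - k)))"
      unfolding u_def w_def by (rule homotopy_components(2,3)[OF B h x])+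
    show ?thesis
    proof (cases "r = k")
      case True
      have Tr: "cmp B (i - int (m - k)) (j - int (m - k)) = T"
        using k True by (simp add: T of_nat_diff algebra_simps)
      have uw': "u \<in> carrier T" "w \<in> carrier T" using uw Tr by simp_all
      have "Dh k = (tdiff B k (i - int (m - k)) (j - int (m - k)) u,
          \<ominus>\<^bsub>T\<^esub> u \<ominus>\<^bsub>T\<^esub> dh k \<oplus>\<^bsub>T\<^esub> w, tdiff B k (i - int (m - k)) (j - int (m - k)) w)"
        unfolding Dh_def huvw using dv True Tr by (simp add: path_def)
      moreover have "(\<ominus>\<^bsub>T\<^esub> u \<ominus>\<^bsub>T\<^esub> dh k \<oplus>\<^bsub>T\<^esub> w) \<oplus>\<^bsub>T\<^esub> dh k = w \<ominus>\<^bsub>T\<^esub> u"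
      proof -
        have "(\<ominus>\<^bsub>T\<^esub> u \<ominus>\<^bsub>T\<^esub> dh k \<oplus>\<^bsub>T\<^esub> w) \<oplus>\<^bsub>T\<^esub> dh k = (w \<ominus>\<^bsub>T\<^esub> u) \<oplus>\<^bsub>T\<^esub> (\<ominus>\<^bsub>T\<^esub> dh k \<oplus>\<^bsub>T\<^esub> dh k)"
          unfolding a_minus_def using uw' dh[OF k] by (simp only: T.M.a_ac T.M.a_closed T.M.a_inv_closed)
        then show ?thesis using uw' dh[OF k] by (simp add: T.M.l_neg)
      qed
      ultimately show ?thesis
        using True uw' dh[OF k] du[OF uw(1)] du[OF uw(2)]
        by (auto simp: P_eq direct_sum3_simps \<pi>_def fm_def gm_def u_def w_def msign_def)
    next
      case False
      have "Dh k = (tdiff B k (i - int (m - k)) (j - int (m - k)) u,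
          msign T (int k + int r + 1) (dh k), tdiff B k (i - int (m - k)) (j - int (m - k)) w)"
        unfolding Dh_def huvw using False[symmetric]
        by (simp only: path_def twisted.simps prod.case if_False T' dv)
      moreover have "msign T (int k + int r + 1) (dh k) \<oplus>\<^bsub>T\<^esub> msign T (int k + int r) (dh k) = \<zero>\<^bsub>T\<^esub>"
        using dh[OF k] by (simp add: msign_def T.M.l_neg T.M.r_neg)
      ultimately show ?thesis
        using False dh[OF k] du[OF uw(1)] du[OF uw(2)] msign_closed[OF T.module_axioms dh[OF k]]
        by (auto simp: P_eq direct_sum3_simps \<pi>_def)
    qed
  qed
  have \<pi>Dh: "\<pi> (Dh k) \<in> carrier T" if "k \<le> m" for k using module_homD(1)[OF \<pi>] Dhc[OF that] by blast
  have "(\<Oplus>\<^bsub>P\<^esub> k\<in>{..m}. Dh k) = (\<Oplus>\<^bsub>P\<^esub> k\<in>{..m}. msign P (int k) (hD k))"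
    unfolding P_def Dh_def hD_def by (rule tmorphismD(2)[OF hm x])
  then have "\<pi> (\<Oplus>\<^bsub>P\<^esub> k\<in>{..m}. Dh k) = \<pi> (\<Oplus>\<^bsub>P\<^esub> k\<in>{..m}. msign P (int k) (hD k))" by simp
  also have "\<pi> (\<Oplus>\<^bsub>P\<^esub> k\<in>{..m}. Dh k) = (\<Oplus>\<^bsub>T\<^esub> k\<in>{..m}. \<pi> (Dh k))"
    by (rule module_hom_finsum[OF P T.module_axioms \<pi>]) (use Dhc in auto)
  also have "\<pi> (\<Oplus>\<^bsub>P\<^esub> k\<in>{..m}. msign P (int k) (hD k)) = (\<Oplus>\<^bsub>T\<^esub> k\<in>{..m}. \<pi> (msign P (int k) (hD k)))"
    by (rule module_hom_finsum[OF P T.module_axioms \<pi>]) (use hD msign_closed[OF P] in auto)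
  also have "\<dots> = (\<Oplus>\<^bsub>T\<^esub> k\<in>{..m}. msign T (int k) (hd k))"
    by (rule T.M.finsum_cong')
      (auto simp: module_hom_msign[OF P T.module_axioms \<pi> hD] hd[symmetric] hdc
        intro!: msign_closed[OF T.module_axioms])
  finally have eq: "(\<Oplus>\<^bsub>T\<^esub> k\<in>{..m}. \<pi> (Dh k)) = (\<Oplus>\<^bsub>T\<^esub> k\<in>{..m}. msign T (int k) (hd k))" .
  have sdh: "(\<lambda>k. msign T (int k + int r) (dh k)) \<in> {..m} \<rightarrow> carrier T"
    using dh by (auto intro!: msign_closed[OF T.module_axioms])
  have "(\<Oplus>\<^bsub>T\<^esub> k\<in>{..m}. msign T (int k + int r) (dh k)) \<oplus>\<^bsub>T\<^esub> (\<Oplus>\<^bsub>T\<^esub> k\<in>{..m}. msign T (int k) (hd k))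
    = (\<Oplus>\<^bsub>T\<^esub> k\<in>{..m}. \<pi> (Dh k)) \<oplus>\<^bsub>T\<^esub> (\<Oplus>\<^bsub>T\<^esub> k\<in>{..m}. msign T (int k + int r) (dh k))"
    unfolding eq using sdh hdc
    by (intro T.M.a_comm T.M.finsum_closed) (auto intro!: msign_closed[OF T.module_axioms])
  also have "\<dots> = (\<Oplus>\<^bsub>T\<^esub> k\<in>{..m}. \<pi> (Dh k) \<oplus>\<^bsub>T\<^esub> msign T (int k + int r) (dh k))"
    by (rule T.M.finsum_addf[symmetric]) (use \<pi>Dh sdh in auto)
  also have "\<dots> = (\<Oplus>\<^bsub>T\<^esub> k\<in>{..m}. if r = k then gm \<ominus>\<^bsub>T\<^esub> fm else \<zero>\<^bsub>T\<^esub>)"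
    by (rule T.M.finsum_cong') (use Dhc fgc in auto)
  also have "\<dots> = (if r \<le> m then gm \<ominus>\<^bsub>T\<^esub> fm else \<zero>\<^bsub>T\<^esub>)"
  proof (cases "r \<le> m")
    case True
    then show ?thesis
      using T.M.finsum_singleton[of r "{..m}" "\<lambda>_. gm \<ominus>\<^bsub>T\<^esub> fm"] fgc by simp
  next
    case False
    then have "(\<Oplus>\<^bsub>T\<^esub> k\<in>{..m}. if r = k then gm \<ominus>\<^bsub>T\<^esub> fm else \<zero>\<^bsub>T\<^esub>) = (\<Oplus>\<^bsub>T\<^esub> k\<in>{..m}. \<zero>\<^bsub>T\<^esub>)"
      by (intro T.M.finsum_cong') auto
    then show ?thesis using False by (simp add: T.M.finsum_zero)
  qed
  finally show ?thesis unfolding dh_def hd_def fm_def gm_def .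
qed

text \<open>The sign \<open>(-1)\<^sup>r\<^sup>(\<^sup>n\<^sup>+\<^sup>1\<^sup>)\<close> turns the equation of the middle component of a homotopy into
  \<open>g - f = d h + h d\<close> on total complexes.\<close>

definition homotopy_matrix ::
  "nat \<Rightarrow> ('a, 'c) twisted \<Rightarrow> ('b, 'c \<times> 'c \<times> 'c) tmap \<Rightarrow> int \<Rightarrow> int \<Rightarrow> int \<Rightarrow> 'b \<Rightarrow> 'c" where
  "homotopy_matrix r B h n =
     sgn_matrix (column B (n - 1)) (int r) n (int r * (n + 1)) (homotopy_middle h)"

section \<open>From homotopies of twisted complexes to homotopies of total complexes\<close>

lemma homotopy_middle_column_hom:
  assumes "homotopy R r A B h f g"
  shows "homotopy_middle h m i (n + i) \<in>
    module_hom R (column A n i) (column B (n - 1) (i + int r - int m))"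
  using homotopy_middle_hom[OF assms, of m i "n + i"] by (simp add: algebra_simps)

lemma matrix_homotopy_matrix:
  assumes "twisted_complex R A" "twisted_complex R B" "homotopy R r A B h f g"
  shows "matrix R (int r) (column A n) (column B (n - 1)) (homotopy_matrix r B h n)"
  unfolding homotopy_matrix_def
  by (rule matrix_sgn_matrix; rule twisted_complexD(1)[OF assms(1)] twisted_complexD(1)[OF assms(2)]
      homotopy_middle_column_hom[OF assms(3)])

text \<open>With m = i + r - j, the product d h has global parity m*n + r*(n + 1) and h d has m*n +
  r*(n + 2). Both reduce to m*n + r*n once d h hands over the factor (-1)^r that the middle equation
  demands. The product of the matrices of \<open>g\<close> and \<open>f\<close> has index m - r and
  parity (m - r)*n, which is the same, so a single sign factors out.\<close>

lemma homotopy_matrix_equation: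
  assumes A: "twisted_complex R A" and B: "twisted_complex R B"
    and f: "tmorphism R A B f" and g: "tmorphism R B A g"
    and h: "homotopy R r A A h (tcomp A g f) (tident A)"
    and x: "x \<in> carrier (column A n i)"
  shows "matrix_comp 0 0 (column A n) (map_matrix A g n) (map_matrix B f n) i j x \<oplus>\<^bsub>column A n j\<^esub>
      (matrix_comp 0 (int r) (column A n) (diff_matrix A (n - 1)) (homotopy_matrix r A h n) i j x
        \<oplus>\<^bsub>column A n j\<^esub>
       matrix_comp (int r) 0 (column A n) (homotopy_matrix r A h (n + 1)) (diff_matrix A n) i j x)
    = (if i = j then x else \<zero>\<^bsub>column A n j\<^esub>)"
    (is "?GF \<oplus>\<^bsub>_\<^esub> (?DH \<oplus>\<^bsub>_\<^esub> ?HD) = _")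
proof -
  note mod = twisted_complexD(1)[OF A]
  define T where "T = column A n j"
  have T: "module R T" unfolding T_def by (rule mod)
  interpret T: module R T by (rule T)
  note above = matrix_comp_above[where P = "column A n" and j = j, OF mod]
  have dn1: "tdiff A m k (n - 1 + k) \<in> module_hom R (column A (n - 1) k) (column A n (k + 0 - int m))"
    for m k using tdiff_column_hom[OF A, of m k "n - 1"] by simp
  have hn1: "homotopy_middle h m k (n + 1 + k) \<in>
      module_hom R (column A (n + 1) k) (column A n (k + int r - int m))" for m k
    using homotopy_middle_column_hom[OF h, of m k "n + 1"] by simp
  have Dn1: "diff_matrix A (n - 1) = sgn_matrix (column A n) 0 (n - 1) 0 (tdiff A)"
    by (simp add: diff_matrix_def)
  have Hn1: "homotopy_matrix r A h (n + 1) =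
      sgn_matrix (column A n) (int r) (n + 1) (int r * (n + 1 + 1)) (homotopy_middle h)"
    by (simp add: homotopy_matrix_def)
  show ?thesis
  \<comment> \<open>Beyond the shift \<open>r\<close> all three products vanish. In the band i < j
    \<le> i + r only the two homotopy terms can be nonzero, and they cancel; for j \<le> i the
    product of \<open>g\<close> and \<open>f\<close> joins them.\<close>
  proof (cases "i + int r < j")
    case True
    then have "?GF = \<zero>\<^bsub>T\<^esub>" "?DH = \<zero>\<^bsub>T\<^esub>" "?HD = \<zero>\<^bsub>T\<^esub>" "i \<noteq> j"
      unfolding T_def by (simp_all add: above)
    then show ?thesis by (simp flip: T_def)
  next
    case False
    then obtain m where m: "j = i + int r - int m" using zle_iff_zadd[of j "i + int r"] by auto
    then have m1: "j = i + int r + 0 - int m" and m2: "j = i + 0 + int r - int m" by simp_all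
    define dh where "dh l = tdiff A l (i + int r - int (m - l)) (n + i + int r - int (m - l) - 1)
      (homotopy_middle h (m - l) i (n + i) x)" for l
    define hd where "hd l = homotopy_middle h l (i - int (m - l)) (n + i - int (m - l) + 1)
      (tdiff A (m - l) i (n + i) x)" for l
    define e where "e = (\<Oplus>\<^bsub>T\<^esub> l\<in>{..m}. msign T (int l + int r) (dh l)) \<oplus>\<^bsub>T\<^esub>
      (\<Oplus>\<^bsub>T\<^esub> l\<in>{..m}. msign T (int l) (hd l))"
    have T_eq: "T = cmp A (i + int r - int m) (n + i + int r - int m)"
      unfolding T_def m by (simp add: algebra_simps)
    have dhc: "dh l \<in> carrier T" if "l \<le> m" for l
      using module_homD(1)[OF twisted_complexD(2)[OF A]
          module_homD(1)[OF homotopy_middle_hom[OF h, of "m - l" i "n + i"] x], of l] that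
      by (simp add: dh_def T_eq of_nat_diff algebra_simps)
    have hdc: "hd l \<in> carrier T" if "l \<le> m" for l
      using module_homD(1)[OF homotopy_middle_hom[OF h]
          module_homD(1)[OF twisted_complexD(2)[OF A, of "m - l" i "n + i"] x], of l] that
      by (simp add: hd_def T_eq of_nat_diff algebra_simps)
    have sc: "(\<lambda>l. msign T (k l) (dh l)) \<in> {..m} \<rightarrow> carrier T"
      "(\<lambda>l. msign T (k l) (hd l)) \<in> {..m} \<rightarrow> carrier T" for k
      using dhc hdc by (auto intro!: msign_closed[OF T])
    have "?DH = msign T (int m * n + int r * (n + 1) + 0)
        (\<Oplus>\<^bsub>T\<^esub> l\<in>{..m}. msign T (int l * (n - 1 - n)) (dh l))"
    proof -
      have eq: "n - 1 + (i + int r - int (m - l)) = n + i + int r - int (m - l) - 1" for l by simp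
      show ?thesis
        unfolding T_def dh_def Dn1 homotopy_matrix_def eq[symmetric]
        by (rule matrix_comp_sgn_matrix[where M = "column A n" and N = "column A (n - 1)"
              and P = "column A n" and u = "homotopy_middle h" and v = "tdiff A" and n = n
              and n' = "n - 1" and s = "int r" and t = 0, OF mod mod mod homotopy_middle_column_hom[OF h] dn1 x m1])
    qed
    also have "\<dots> = msign T (int m * n + int r * n)
        (msign T (int r) (\<Oplus>\<^bsub>T\<^esub> l\<in>{..m}. msign T (int l * (n - 1 - n)) (dh l)))"
      unfolding msign_msign[OF T T.M.finsum_closed[OF sc(1)]]
      by (rule msign_parity) (simp add: algebra_simps)
    also have "msign T (int r) (\<Oplus>\<^bsub>T\<^esub> l\<in>{..m}. msign T (int l * (n - 1 - n)) (dh l)) =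
        (\<Oplus>\<^bsub>T\<^esub> l\<in>{..m}. msign T (int r) (msign T (int l * (n - 1 - n)) (dh l)))"
      by (rule module_hom_finsum[OF T T msign_hom[OF T] _ sc(1)]) simp
    also have "\<dots> = (\<Oplus>\<^bsub>T\<^esub> l\<in>{..m}. msign T (int l + int r) (dh l))"
      by (rule T.M.finsum_cong'[OF refl sc(1)])
        (simp add: msign_def dhc)
    finally have DH: "?DH = msign T (int m * n + int r * n) (\<Oplus>\<^bsub>T\<^esub> l\<in>{..m}. msign T (int l + int r) (dh l))" .
    have "?HD = msign T (int m * n + 0 + int r * (n + 1 + 1))
        (\<Oplus>\<^bsub>T\<^esub> l\<in>{..m}. msign T (int l * (n + 1 - n)) (hd l))"
    proof -
      have eq: "n + 1 + (i + 0 - int (m - l)) = n + i - int (m - l) + 1"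
        and eq': "i + 0 - int (m - l) = i - int (m - l)" for l by simp_all
      show ?thesis
        unfolding T_def hd_def Hn1 diff_matrix_def eq[symmetric] eq'[symmetric]
        by (rule matrix_comp_sgn_matrix[where M = "column A n" and N = "column A (n + 1)"
              and P = "column A n" and u = "tdiff A" and v = "homotopy_middle h" and n = n
              and n' = "n + 1" and s = 0 and t = "int r", OF mod mod mod tdiff_column_hom[OF A] hn1 x m2])
    qed
    also have "\<dots> = msign T (int m * n + int r * n) (\<Oplus>\<^bsub>T\<^esub> l\<in>{..m}. msign T (int l) (hd l))"
    proof -
      have "(\<Oplus>\<^bsub>T\<^esub> l\<in>{..m}. msign T (int l * (n + 1 - n)) (hd l)) =
          (\<Oplus>\<^bsub>T\<^esub> l\<in>{..m}. msign T (int l) (hd l))" by simp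
      then show ?thesis by (simp only:) (rule msign_parity, simp add: algebra_simps)
    qed
    finally have HD: "?HD = msign T (int m * n + int r * n) (\<Oplus>\<^bsub>T\<^esub> l\<in>{..m}. msign T (int l) (hd l))" .
    have "?DH \<oplus>\<^bsub>T\<^esub> ?HD = msign T (int m * n + int r * n) e"
      unfolding DH HD e_def
      by (rule module_homD(2)[OF msign_hom[OF T], symmetric]) (rule T.M.finsum_closed[OF sc(1)] T.M.finsum_closed[OF sc(2)])+
    moreover have e: "e = (if r \<le> m then tident A (m - r) i (n + i) x \<ominus>\<^bsub>T\<^esub> tcomp A g f (m - r) i (n + i) x
        else \<zero>\<^bsub>T\<^esub>)"
      unfolding e_def dh_def hd_def
      by (rule homotopy_middle_equation[OF A A h x T_eq])
    moreover have "?GF \<oplus>\<^bsub>T\<^esub> msign T (int m * n + int r * n) e = (if i = j then x else \<zero>\<^bsub>T\<^esub>)"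
    proof (cases "r \<le> m")
      case True
      then have j: "j = i - int (m - r)" using m by (simp add: of_nat_diff)
      have GF: "?GF = msign T (int m * n + int r * n) (tcomp A g f (m - r) i (n + i) x)"
        unfolding map_matrix_map_matrix[OF A B A f g x j] T_def
        by (rule msign_parity) (simp add: of_nat_diff[OF True] algebra_simps)
      have "n + i - int (m - r) = n + j" using j by simp
      then have T_eq': "cmp A (i - int (m - r)) (n + i - int (m - r)) = T"
        by (simp only: T_def j)
      have c: "tcomp A g f (m - r) i (n + i) x \<in> carrier T" "tident A (m - r) i (n + i) x \<in> carrier T"
        using homotopy_components(2,3)[OF A h x, of "m - r"] by (simp_all only: T_eq')
      have id: "tident A (m - r) i (n + i) x = (if i = j then x else \<zero>\<^bsub>T\<^esub>)"
        unfolding tident_def strict_tmap_def T_eq' using True m by auto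
      have "?GF \<oplus>\<^bsub>T\<^esub> msign T (int m * n + int r * n) e =
          msign T (int m * n + int r * n) (tcomp A g f (m - r) i (n + i) x \<oplus>\<^bsub>T\<^esub> e)"
        unfolding GF using c True
        by (intro module_homD(2)[OF msign_hom[OF T], symmetric]) (auto simp: e)
      also have "tcomp A g f (m - r) i (n + i) x \<oplus>\<^bsub>T\<^esub> e = tident A (m - r) i (n + i) x"
        using c True by (simp add: e a_minus_def T.M.a_lcomm T.M.r_neg)
      \<comment> \<open>On the diagonal m = r, so the parity is 2*r*n and the identity carries no
        sign; off the diagonal the sign acts on zero.\<close>
      also have "msign T (int m * n + int r * n) (tident A (m - r) i (n + i) x) = (if i = j then x else \<zero>\<^bsub>T\<^esub>)"
        unfolding id using m by (auto simp: msign_def)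
      finally show ?thesis .
    next
      case False
      then have "i < j" using m by simp
      then have "?GF = \<zero>\<^bsub>T\<^esub>" unfolding T_def by (simp add: above)
      then show ?thesis using False \<open>i < j\<close> e by (simp add: msign_def)
    qed
    ultimately show ?thesis by (simp flip: T_def)
  qed
qed

text \<open>The entrywise identity is summed over all source columns, where the identity matrix
  leaves the single component \<open>a j\<close>.\<close>

lemma homotopy_Tot:
  assumes A: "twisted_complex R A" and B: "twisted_complex R B"
    and f: "tmorphism R A B f" and g: "tmorphism R B A g"
    and "homotopic R r A A (tcomp A g f) (tident A)"
  obtains H where "\<And>p n a. a \<in> fc_filt (Tot A) p n \<Longrightarrow> H n a \<in> fc_filt (Tot A) (p + int r) (n - 1)"
    and "\<And>n a. a \<in> carrier (fc_mod (Tot A) n) \<Longrightarrow> a = tot_map B A g n (tot_map A B f n a) \<oplus>\<^bsub>fc_mod (Tot A) n\<^esub>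
      (fc_diff (Tot A) (n - 1) (H n a) \<oplus>\<^bsub>fc_mod (Tot A) n\<^esub> H (n + 1) (fc_diff (Tot A) n a))"
proof -
  obtain h where h: "homotopy R r A A h (tcomp A g f) (tident A)"
    using assms(5) by (auto simp: homotopic_def)
  define H where "H n = matrix_map (int r) (column A n) (column A (n - 1)) (homotopy_matrix r A h n)" for n
  note HM = matrix_homotopy_matrix[OF A A h] and mod = twisted_complexD(1)[OF A]
  show thesis
  proof (rule that[of H])
    fix p n a assume "a \<in> fc_filt (Tot A) p n"
    then show "H n a \<in> fc_filt (Tot A) (p + int r) (n - 1)"
      using matrix.matrix_map_filt[OF HM, of a n p] by (simp add: Tot_def tot_filt_eq H_def)
  next
    fix n a assume a: "a \<in> carrier (fc_mod (Tot A) n)"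
    show "a = tot_map B A g n (tot_map A B f n a) \<oplus>\<^bsub>fc_mod (Tot A) n\<^esub>
      (fc_diff (Tot A) (n - 1) (H n a) \<oplus>\<^bsub>fc_mod (Tot A) n\<^esub> H (n + 1) (fc_diff (Tot A) n a))"
    proof
      fix j
      define T where "T = column A n j"
      have T: "module R T" unfolding T_def by (rule mod)
      interpret T: module R T by (rule T)
      have a': "a \<in> carrier (tot_mod A n)" using a by (simp add: Tot_def)
      \<comment> \<open>The bound is taken at least \<open>j\<close> so that the diagonal index
        \<open>j\<close> belongs to the common index set; otherwise the term \<open>a j\<close>
        would be missing from the sum.\<close>
      then obtain p where p: "a \<in> family_filt (column A n) p" and jp: "p \<ge> j"
        unfolding tot_mod_eq by (rule carrier_family_totE)
      \<comment> \<open>One interval serves all three products. The shift of the homotopy extends it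
        down to j - r, and on the added columns the product of \<open>g\<close> and \<open>f\<close>
        has zero entries.\<close>
      let ?S = "{j - int r..p}"
      have ac: "a i \<in> carrier (column A n i)" for i by (rule family_filtD(1)[OF p])
      note Fm = matrix_map_matrix[OF A B f, of n] and Gm = matrix_map_matrix[OF B A g, of n]
      have D1: "matrix R 0 (column A (n - 1)) (column A n) (diff_matrix A (n - 1))"
        using matrix_diff_matrix[OF A, of "n - 1"] by simp
      have H1: "matrix R (int r) (column A (n + 1)) (column A n) (homotopy_matrix r A h (n + 1))"
        using HM[of "n + 1"] by simp
      define GF DH HD where
        "GF = matrix_comp 0 0 (column A n) (map_matrix A g n) (map_matrix B f n)" and
        "DH = matrix_comp 0 (int r) (column A n) (diff_matrix A (n - 1)) (homotopy_matrix r A h n)" and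
        "HD = matrix_comp (int r) 0 (column A n) (homotopy_matrix r A h (n + 1)) (diff_matrix A n)"
      have c: "GF i j (a i) \<in> carrier T" "DH i j (a i) \<in> carrier T" "HD i j (a i) \<in> carrier T" for i
        unfolding GF_def DH_def HD_def T_def
        by (rule matrix_comp_closed[OF Fm Gm ac] matrix_comp_closed[OF HM D1 ac]
            matrix_comp_closed[OF matrix_diff_matrix[OF A] H1 ac])+
      have fa: "tot_map A B f n a \<in> carrier (tot_mod B n)"
        using filtered_map.map_closed[OF filtered_map_Tot[OF A B f], of a n] a by (simp add: Tot_def)
      have "tot_map B A g n (tot_map A B f n a) j =
          matrix_map 0 (column B n) (column A n) (map_matrix A g n)
            (matrix_map 0 (column A n) (column B n) (map_matrix B f n) a) j"
        using tot_map_eq[OF B A g fa] unfolding tot_map_eq[OF A B f a'] by simp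
      also have "\<dots> = (\<Oplus>\<^bsub>T\<^esub> i\<in>?S. GF i j (a i))"
        unfolding GF_def T_def by (rule matrix_map_matrix_map[OF Fm Gm p]) auto
      finally have eq1: "tot_map B A g n (tot_map A B f n a) j = (\<Oplus>\<^bsub>T\<^esub> i\<in>?S. GF i j (a i))" .
      have Ha: "H n a \<in> carrier (tot_mod A (n - 1))"
        unfolding H_def tot_mod_eq
        using matrix.matrix_map_filt[OF HM p] family_filt_subset by blast
      have "fc_diff (Tot A) (n - 1) (H n a) j =
          matrix_map 0 (column A (n - 1)) (column A n) (diff_matrix A (n - 1))
            (matrix_map (int r) (column A n) (column A (n - 1)) (homotopy_matrix r A h n) a) j"
        using tot_diff_eq[OF A Ha] by (simp add: Tot_def H_def)
      also have "\<dots> = (\<Oplus>\<^bsub>T\<^esub> i\<in>?S. DH i j (a i))"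
        unfolding DH_def T_def by (rule matrix_map_matrix_map[OF HM D1 p]) auto
      finally have eq2: "fc_diff (Tot A) (n - 1) (H n a) j = (\<Oplus>\<^bsub>T\<^esub> i\<in>?S. DH i j (a i))" .
      have "H (n + 1) (fc_diff (Tot A) n a) j =
          matrix_map (int r) (column A (n + 1)) (column A n) (homotopy_matrix r A h (n + 1))
            (matrix_map 0 (column A n) (column A (n + 1)) (diff_matrix A n) a) j"
        using tot_diff_eq[OF A a'] by (simp add: Tot_def H_def)
      also have "\<dots> = (\<Oplus>\<^bsub>T\<^esub> i\<in>?S. HD i j (a i))"
        unfolding HD_def T_def by (rule matrix_map_matrix_map[OF matrix_diff_matrix[OF A] H1 p]) auto
      finally have eq3: "H (n + 1) (fc_diff (Tot A) n a) j = (\<Oplus>\<^bsub>T\<^esub> i\<in>?S. HD i j (a i))" .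
      have "(tot_map B A g n (tot_map A B f n a) \<oplus>\<^bsub>fc_mod (Tot A) n\<^esub>
          (fc_diff (Tot A) (n - 1) (H n a) \<oplus>\<^bsub>fc_mod (Tot A) n\<^esub> H (n + 1) (fc_diff (Tot A) n a))) j
        = (\<Oplus>\<^bsub>T\<^esub> i\<in>?S. GF i j (a i)) \<oplus>\<^bsub>T\<^esub> ((\<Oplus>\<^bsub>T\<^esub> i\<in>?S. DH i j (a i)) \<oplus>\<^bsub>T\<^esub> (\<Oplus>\<^bsub>T\<^esub> i\<in>?S. HD i j (a i)))"
        unfolding eq1[symmetric] eq2[symmetric] eq3[symmetric] by (simp add: Tot_def tot_mod_def T_def)
      also have "\<dots> = (\<Oplus>\<^bsub>T\<^esub> i\<in>?S. GF i j (a i) \<oplus>\<^bsub>T\<^esub> (DH i j (a i) \<oplus>\<^bsub>T\<^esub> HD i j (a i)))"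
        using c by (simp add: T.M.finsum_addf)
      also have "\<dots> = (\<Oplus>\<^bsub>T\<^esub> i\<in>?S. if j = i then a j else \<zero>\<^bsub>T\<^esub>)"
      proof (rule T.M.finsum_cong'[OF refl])
        show "GF i j (a i) \<oplus>\<^bsub>T\<^esub> (DH i j (a i) \<oplus>\<^bsub>T\<^esub> HD i j (a i)) = (if j = i then a j else \<zero>\<^bsub>T\<^esub>)" for i
          unfolding GF_def DH_def HD_def T_def homotopy_matrix_equation[OF A B f g h ac] by auto
      qed (use ac[of j] in \<open>auto simp flip: T_def\<close>)
      also have "\<dots> = a j"
        using jp ac[of j] by (intro T.M.finsum_singleton) (auto simp: T_def)
      finally show "a j = (tot_map B A g n (tot_map A B f n a) \<oplus>\<^bsub>fc_mod (Tot A) n\<^esub>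
          (fc_diff (Tot A) (n - 1) (H n a) \<oplus>\<^bsub>fc_mod (Tot A) n\<^esub> H (n + 1) (fc_diff (Tot A) n a))) j"
        by (rule sym)
    qed
  qed
qed

theorem proposition3p24:
  fixes R :: "'a ring" and r :: nat
  assumes "cring R"
  shows "(homotopy_equivalences R r ::
           (('a, 'b) twisted \<times> ('a, 'c) twisted \<times> ('b, 'c) tmap) set)
         \<subseteq> E_quasi_isos R r"
proof
  fix x :: "('a, 'b) twisted \<times> ('a, 'c) twisted \<times> ('b, 'c) tmap"
  assume x: "x \<in> homotopy_equivalences R r"
  obtain A B f where ABf: "x = (A, B, f)" by (cases x)
  with x have A: "twisted_complex R A" and B: "twisted_complex R B" and f: "tmorphism R A B f"
    and "homotopy_equivalence R r A B f"
    by (auto simp: homotopy_equivalences_def)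
  then obtain g where g: "tmorphism R B A g"
    and fg: "homotopic R r B B (tcomp B f g) (tident B)"
    and gf: "homotopic R r A A (tcomp A g f) (tident A)"
    by (auto simp: homotopy_equivalence_def)
  obtain H where H: "\<And>p n a. a \<in> fc_filt (Tot A) p n \<Longrightarrow> H n a \<in> fc_filt (Tot A) (p + int r) (n - 1)"
    "\<And>n a. a \<in> carrier (fc_mod (Tot A) n) \<Longrightarrow> a = tot_map B A g n (tot_map A B f n a) \<oplus>\<^bsub>fc_mod (Tot A) n\<^esub>
      (fc_diff (Tot A) (n - 1) (H n a) \<oplus>\<^bsub>fc_mod (Tot A) n\<^esub> H (n + 1) (fc_diff (Tot A) n a))"
    by (rule homotopy_Tot[OF A B f g gf]) (rule that)
  obtain K where K: "\<And>p n a. a \<in> fc_filt (Tot B) p n \<Longrightarrow> K n a \<in> fc_filt (Tot B) (p + int r) (n - 1)"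
    "\<And>n a. a \<in> carrier (fc_mod (Tot B) n) \<Longrightarrow> a = tot_map A B f n (tot_map B A g n a) \<oplus>\<^bsub>fc_mod (Tot B) n\<^esub>
      (fc_diff (Tot B) (n - 1) (K n a) \<oplus>\<^bsub>fc_mod (Tot B) n\<^esub> K (n + 1) (fc_diff (Tot B) n a))"
    by (rule homotopy_Tot[OF B A g f fg]) (rule that)
  have "E_quasi_iso R r A B f"
    unfolding E_quasi_iso_def
    by (intro allI homotopy_equivalence_ss_homology_iso[OF filtered_map_Tot[OF A B f]
          filtered_map_Tot[OF B A g], where h = H and k = K] H K)
  then show "x \<in> E_quasi_isos R r"
    using A B f ABf by (simp add: E_quasi_isos_def)
qed

end
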